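(* Let $I=(F_1,F_2,\dots,F_{n+1})\subset k[x_1,\dots,x_n]$ be a height $n$ almost complete intersection Artinian ideal with homogeneous generators of degrees $d_1,\dots,d_n,d_{n+1}$. Assume that $d_{n+1}\ge\left\lceil\frac{d_1+\dots+d_n}{2}\right\rceil-1$, that $F_1,\dots,F_n$ form a regular sequence, and that $d_n>d_1+\dots+d_{n-1}-n$ if $d_1+\dots+d_{n-1}+d_n-n$ is even, respectively $d_n>d_1+\dots+d_{n-1}-n+1$ if $d_1+\dots+d_{n-1}+d_n-n$ is odd. Then $k[x_1,\dots,x_n]/I$ has the Weak Lefschetz property.
   Context: $k$ is an infinite field and $k[x_1,\dots,x_n]$ is standard graded. For a real number $x$, $\lceil x\rceil=\min\{m\in\mathbb Z\mid m\ge x\}$. A standard graded Artinian $k$-algebra $A=\bigoplus A_i$ has the Weak Lefschetz property if for a general linear form $L$ the multiplication map $\times L:A_i\to A_{i+1}$ has maximal rank (is injective or surjective) for every $i$. *)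

theory Defs
  imports Complex_Main "HOL-Library.Poly_Mapping" "HOL-Library.Extended_Nat"
begin

text \<open>The polynomial ring \<open>k[x\<^sub>1,\<dots>,x\<^sub>n]\<close>: the variables are indexed by the finite type \<open>'n\<close>,
  so \<open>n = card (UNIV :: 'n set)\<close>, and a polynomial maps exponent vectors to coefficients.\<close>

type_synonym ('n, 'k) mpol = "('n \<Rightarrow>\<^sub>0 nat) \<Rightarrow>\<^sub>0 'k"

definition monom_deg :: "('n::finite \<Rightarrow>\<^sub>0 nat) \<Rightarrow> nat" where
  "monom_deg m = (\<Sum>i\<in>UNIV. Poly_Mapping.lookup m i)"

text \<open>The graded piece of degree \<open>d\<close>; as a vector space it contains 0.\<close>

definition forms :: "nat \<Rightarrow> ('n::finite, 'k::field) mpol set" where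
  "forms d = {f. \<forall>m\<in>Poly_Mapping.keys f. monom_deg m = d}"

definition eval :: "('n::finite, 'k::field) mpol \<Rightarrow> ('n \<Rightarrow> 'k) \<Rightarrow> 'k" where
  "eval p a = (\<Sum>m\<in>Poly_Mapping.keys p.
      Poly_Mapping.lookup p m * (\<Prod>i\<in>UNIV. a i ^ Poly_Mapping.lookup m i))"

definition linear_form :: "('n::finite \<Rightarrow> 'k::field) \<Rightarrow> ('n, 'k) mpol" where
  "linear_form a = (\<Sum>i\<in>UNIV. Poly_Mapping.single (Poly_Mapping.single i 1) (a i))"


text \<open>Ideals are the submodules of the ring regarded as a module over itself.\<close>

abbreviation is_ideal :: "'r::comm_ring_1 set \<Rightarrow> bool" where
  "is_ideal \<equiv> module.subspace (*)"

abbreviation ideal_gen :: "'r::comm_ring_1 set \<Rightarrow> 'r set" where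
  "ideal_gen \<equiv> module.span (*)"

definition is_prime_ideal :: "'r::comm_ring_1 set \<Rightarrow> bool" where
  "is_prime_ideal P \<longleftrightarrow> is_ideal P \<and> P \<noteq> UNIV \<and> (\<forall>a b. a * b \<in> P \<longrightarrow> a \<in> P \<or> b \<in> P)"

definition prime_height :: "'r::comm_ring_1 set \<Rightarrow> enat" where
  "prime_height P = Sup {enat r | r. \<exists>Q :: nat \<Rightarrow> 'r set.
      (\<forall>i\<le>r. is_prime_ideal (Q i)) \<and> (\<forall>i<r. Q i \<subset> Q (Suc i)) \<and> Q r = P}"

definition height :: "'r::comm_ring_1 set \<Rightarrow> enat" where
  "height I = Inf {prime_height P | P. is_prime_ideal P \<and> I \<subseteq> P}"

text \<open>Only meaningful for finitely generated ideals.\<close>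

definition min_num_gens :: "'r::comm_ring_1 set \<Rightarrow> nat" where
  "min_num_gens I = (LEAST m. \<exists>S. finite S \<and> card S = m \<and> ideal_gen S = I)"

definition almost_complete_intersection :: "'r::comm_ring_1 set \<Rightarrow> bool" where
  "almost_complete_intersection I \<longleftrightarrow> is_ideal I \<and> enat (min_num_gens I) = height I + 1"

text \<open>An ideal is called Artinian if its quotient ring is Artinian.  Ideals of the quotient by
  \<open>I\<close> correspond to ideals containing \<open>I\<close>, so this is the descending chain condition on the latter.\<close>

definition artinian_ideal :: "'r::comm_ring_1 set \<Rightarrow> bool" where
  "artinian_ideal I \<longleftrightarrow> is_ideal I \<and>
     wf {(J, K). is_ideal J \<and> is_ideal K \<and> I \<subseteq> J \<and> J \<subset> K}"

text \<open>\<open>F 1, \<dots>, F r\<close> is a regular sequence; indices start at 1.\<close>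

definition regular_sequence :: "(nat \<Rightarrow> 'r::comm_ring_1) \<Rightarrow> nat \<Rightarrow> bool" where
  "regular_sequence F r \<longleftrightarrow> ideal_gen (F ` {1..r}) \<noteq> UNIV \<and>
     (\<forall>j\<in>{1..r}. \<forall>g. F j * g \<in> ideal_gen (F ` {1..<j}) \<longrightarrow> g \<in> ideal_gen (F ` {1..<j}))"


definition cong_rel :: "'r::comm_ring_1 set \<Rightarrow> ('r \<times> 'r) set" where
  "cong_rel I = {(f, g). f - g \<in> I}"

text \<open>The degree \<open>i\<close> piece of the quotient by a homogeneous ideal \<open>I\<close>: all cosets \<open>f + I\<close>
  (as subsets of the whole polynomial ring) with \<open>f\<close> a form of degree \<open>i\<close>.\<close>

definition quot_piece :: "('n::finite, 'k::field) mpol set \<Rightarrow> nat \<Rightarrow> ('n, 'k) mpol set set" where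
  "quot_piece I i = forms i // cong_rel I"

text \<open>Multiplication by \<open>L\<close> on cosets, \<open>f + I \<mapsto> L f + I\<close>.\<close>

definition quot_mult :: "'r::comm_ring_1 set \<Rightarrow> 'r \<Rightarrow> 'r set \<Rightarrow> 'r set" where
  "quot_mult I L C = cong_rel I `` ((*) L ` C)"

definition maximal_rank_at :: "('n::finite, 'k::field) mpol set \<Rightarrow> ('n, 'k) mpol \<Rightarrow> nat \<Rightarrow> bool" where
  "maximal_rank_at I L i \<longleftrightarrow>
     inj_on (quot_mult I L) (quot_piece I i) \<or>
     quot_mult I L ` quot_piece I i = quot_piece I (Suc i)"

definition zariski_open :: "('n::finite \<Rightarrow> 'k::field) set \<Rightarrow> bool" where
  "zariski_open U \<longleftrightarrow> (\<exists>S :: ('n, 'k) mpol set. U = {a. \<exists>p\<in>S. eval p a \<noteq> 0})"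

text \<open>``For a general linear form'' means on a nonempty Zariski open subset of the affine space
  of coefficient vectors of linear forms.\<close>

definition weak_lefschetz :: "('n::finite, 'k::field) mpol set \<Rightarrow> bool" where
  "weak_lefschetz I \<longleftrightarrow> (\<exists>U :: ('n \<Rightarrow> 'k) set. zariski_open U \<and> U \<noteq> {} \<and>
     (\<forall>a\<in>U. \<forall>i. maximal_rank_at I (linear_form a) i))"

end

theory Submission
  imports Defs "HOL-Computational_Algebra.Polynomial_FPS"
begin

text \<open>
  Write \<open>R\<close> for the polynomial ring, \<open>J\<close> for the ideal of \<open>F 1, \<dots>, F (n - 1)\<close>, \<open>L\<close> for a general linear form
  and \<open>e\<close> for the sum of \<open>d j - 1\<close> over \<open>j < n\<close>.  Everything rests on one fact about \<open>R / J\<close>, which has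
  dimension one: multiplication by \<open>L\<close> is injective in the degrees up to \<open>e\<close> and surjective in the degrees
  from \<open>e\<close> on (\<open>generic_section_of_regular_sequence\<close>).

  Surjectivity passes to \<open>R / I\<close>, which settles the degrees \<open>i \<ge> e\<close>.  The hypotheses on degree and parity
  give \<open>d n \<ge> e + 1\<close>.  So for \<open>i < e\<close> the form \<open>F n\<close> is invisible in degree \<open>i + 1\<close>, and if
  \<open>d (n + 1) > i + 1\<close> as well then \<open>I\<close> and \<open>J\<close> agree there and injectivity passes to \<open>R / I\<close>.  The bound on
  \<open>d (n + 1)\<close> leaves a single exception: \<open>n = 2\<close>, \<open>d 1 = e + 1\<close> and \<open>d 3 = e = i + 1\<close>.  Then \<open>I\<close> consists in
  degree \<open>e\<close> of the scalar multiples of \<open>F 3\<close>, and it suffices that \<open>L\<close> does not divide \<open>F 3\<close>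
  (\<open>generic_not_divisor\<close>).

  Injectivity modulo \<open>J\<close>: the form \<open>F n\<close> is regular modulo \<open>J\<close> and has positive degree, so no \<open>c\<close> outside \<open>J\<close>
  is multiplied into \<open>J\<close> by all variables.  If \<open>L\<close> failed to be injective up to degree \<open>e\<close> for every
  choice of its coefficients, elimination (\<open>generic_independence_or_relation\<close>) would produce a syzygy whose coefficients are polynomial
  in those of \<open>L\<close>; restricted to a curve in the space of linear forms it makes a univariate polynomial with
  all variables among its coefficients a zero divisor modulo \<open>J\<close>, and McCoy's theorem (\<open>McCoy\<close>) would yield
  such a \<open>c\<close>.  Elimination also shows that the good linear forms contain a nonempty open set.

  Surjectivity modulo \<open>J\<close>: the Hilbert series of \<open>R / J\<close> times \<open>1 - t\<close> is a polynomial of degree \<open>e\<close>, so the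
  graded pieces of degrees \<open>e\<close> and \<open>e + 1\<close> have equal dimension (\<open>hilbert_stable\<close>).  Injectivity in degree \<open>e\<close>
  therefore gives surjectivity, which propagates upwards.
\<close>

section \<open>Dimension counts\<close>

context vector_space
begin

text \<open>The map \<open>\<phi>\<close> induces an injection \<open>V / W \<rightarrow> (U + \<phi> V) / U\<close>, which is onto; the equation compares
  dimensions, written without subtraction.  With \<open>\<phi>\<close> the multiplication by a form that is regular modulo
  an ideal, this is how Hilbert functions change when a generator is added.\<close>

lemma dim_sum_image:
  assumes lin: "Vector_Spaces.linear scale scale \<phi>"
    and sub: "subspace U" "subspace V" "subspace W" "W \<subseteq> V"
    and fin: "finite X" "V \<subseteq> span X" "finite Y" "U \<subseteq> span Y"
    and ker: "\<And>v. v \<in> V \<Longrightarrow> \<phi> v \<in> U \<longleftrightarrow> v \<in> W"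
  shows "dim {u + \<phi> v | u v. u \<in> U \<and> v \<in> V} + dim W = dim U + dim V"
proof -
  let ?T = "{u + \<phi> v | u v. u \<in> U \<and> v \<in> V}"
  interpret \<phi>: Vector_Spaces.linear scale scale \<phi> by (fact lin)
  obtain B where B: "B \<subseteq> W" "independent B" "W \<subseteq> span B" "card B = dim W"
    by (rule basis_exists)
  obtain B' where B': "B \<subseteq> B'" "B' \<subseteq> V" "independent B'" "V \<subseteq> span B'"
    using maximal_independent_subset_extend[OF subset_trans[OF B(1) sub(4)] B(2)] by blast
  obtain D where D: "D \<subseteq> U" "independent D" "U \<subseteq> span D" "card D = dim U"
    by (rule basis_exists)
  have finB': "finite B'" using independent_span_bound[OF fin(1) B'(3)] B'(2) fin(2) by auto
  have finD: "finite D" using independent_span_bound[OF fin(3) D(2)] D(1) fin(4) by auto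
  define C where "C = B' - B"
  have finC: "finite C" using finB' by (simp add: C_def)
  have finB: "finite B" using finB' B'(1) by (rule finite_subset[rotated])
  have spanB: "span B = W" by (rule span_subspace[OF B(1,3) sub(3)])
  have spanD: "span D = U" by (rule span_subspace[OF D(1,3) sub(1)])
  have CV: "C \<subseteq> V" using B' C_def by auto
  \<comment> \<open>The vectors of \<open>C\<close> stay independent modulo \<open>W\<close>, hence so do their images modulo \<open>U\<close>.\<close>
  have key: "a c = 0" if "\<phi> (\<Sum>c\<in>C. scale (a c) c) \<in> U" "c \<in> C" for a c
  proof -
    have "(\<Sum>c\<in>C. scale (a c) c) \<in> V"
      using CV by (intro subspace_sum[OF sub(2)] subspace_scale[OF sub(2)]) auto
    then have "(\<Sum>c\<in>C. scale (a c) c) \<in> span B" using ker that spanB by blast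
    then obtain b where b: "(\<Sum>c\<in>C. scale (a c) c) = (\<Sum>v\<in>B. scale (b v) v)"
      unfolding span_finite[OF finB] by auto
    have "(\<Sum>v\<in>B'. scale (if v \<in> C then a v else - b v) v)
        = (\<Sum>v\<in>C. scale (if v \<in> C then a v else - b v) v)
          + (\<Sum>v\<in>B. scale (if v \<in> C then a v else - b v) v)"
      using B'(1) finB finC by (subst sum.union_disjoint[symmetric]) (auto simp: C_def intro!: sum.cong)
    also have "(\<Sum>v\<in>B. scale (if v \<in> C then a v else - b v) v) = - (\<Sum>v\<in>B. scale (b v) v)"
      by (subst sum_negf[symmetric], rule sum.cong) (auto simp: C_def)
    also have "(\<Sum>v\<in>C. scale (if v \<in> C then a v else - b v) v) = (\<Sum>v\<in>C. scale (a v) v)"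
      by (rule sum.cong) auto
    finally have "(\<Sum>v\<in>B'. scale (if v \<in> C then a v else - b v) v) = 0" using b by simp
    from independentD[OF B'(3) finB' subset_refl this, of c] that(2) show ?thesis
      by (auto simp: C_def)
  qed
  have inj: "inj_on \<phi> C"
  proof (rule inj_onI, rule ccontr)
    fix x y assume xy: "x \<in> C" "y \<in> C" "\<phi> x = \<phi> y" "x \<noteq> y"
    let ?a = "\<lambda>c. if c = x then 1 else if c = y then -1 else 0"
    have "(\<Sum>c\<in>C. scale (?a c) c) = (\<Sum>c\<in>{x,y}. scale (?a c) c)"
      using xy finC by (intro sum.mono_neutral_right) auto
    then have "\<phi> (\<Sum>c\<in>C. scale (?a c) c) = 0" using xy by (simp add: \<phi>.diff)
    with key[of ?a x] xy subspace_0[OF sub(1)] show False by auto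
  qed
  have disj: "D \<inter> \<phi> ` C = {}"
  proof (rule ccontr)
    assume "\<not> ?thesis"
    then obtain c where c: "c \<in> C" "\<phi> c \<in> U" using D by auto
    let ?a = "\<lambda>d. if d = c then 1 else 0"
    have "(\<Sum>d\<in>C. scale (?a d) d) = (\<Sum>d\<in>{c}. scale (?a d) d)"
      using c finC by (intro sum.mono_neutral_right) auto
    with key[of ?a c] c show False by auto
  qed
  have ind: "independent (D \<union> \<phi> ` C)"
  proof -
    have "u v = 0" if u: "(\<Sum>v\<in>D \<union> \<phi> ` C. scale (u v) v) = 0" and v: "v \<in> D \<union> \<phi> ` C" for u v
    proof -
      have "(\<Sum>v\<in>D \<union> \<phi> ` C. scale (u v) v)
          = (\<Sum>v\<in>D. scale (u v) v) + (\<Sum>v\<in>\<phi> ` C. scale (u v) v)"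
        using finD finC disj by (intro sum.union_disjoint) auto
      also have "(\<Sum>v\<in>\<phi> ` C. scale (u v) v) = \<phi> (\<Sum>c\<in>C. scale (u (\<phi> c)) c)"
        using inj by (simp add: sum.reindex \<phi>.sum \<phi>.scale)
      finally have eq: "\<phi> (\<Sum>c\<in>C. scale (u (\<phi> c)) c) = - (\<Sum>v\<in>D. scale (u v) v)"
        using u by (simp add: add_eq_0_iff2 add.commute)
      also have "\<dots> \<in> U" unfolding spanD[symmetric]
        by (intro span_neg span_sum span_scale span_base)
      finally have z: "u (\<phi> c) = 0" if "c \<in> C" for c using key[of "\<lambda>c. u (\<phi> c)"] that by blast
      then have "(\<Sum>c\<in>C. scale (u (\<phi> c)) c) = 0" by simp
      with eq have "(\<Sum>v\<in>D. scale (u v) v) = 0" by simp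
      from independentD[OF D(2) finD subset_refl this] z v show ?thesis by auto
    qed
    then show ?thesis using finD finC by (auto simp: dependent_finite)
  qed
  have sp: "?T \<subseteq> span (D \<union> \<phi> ` C)"
  proof clarify
    fix u v assume uv: "u \<in> U" "v \<in> V"
    have "B \<union> C = B'" using B'(1) by (auto simp: C_def)
    then have "v \<in> span (B \<union> C)" using uv(2) B'(4) by auto
    then obtain b c where bc: "b \<in> span B" "c \<in> span C" "v = b + c" unfolding span_Un by auto
    have "\<phi> b \<in> U" using bc(1) ker spanB sub(4) by auto
    then have "u + \<phi> b \<in> span D" using spanD uv subspace_add[OF sub(1)] by auto
    moreover have "\<phi> c \<in> span (\<phi> ` C)" using bc(2) \<phi>.span_image by auto
    ultimately have "(u + \<phi> b) + \<phi> c \<in> span (D \<union> \<phi> ` C)"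
      by (meson Un_upper1 Un_upper2 span_add span_mono subsetD)
    then show "u + \<phi> v \<in> span (D \<union> \<phi> ` C)" using bc by (simp add: \<phi>.add add.assoc)
  qed
  have DT: "D \<union> \<phi> ` C \<subseteq> ?T"
  proof
    fix x assume "x \<in> D \<union> \<phi> ` C"
    then consider "x \<in> U" | c where "c \<in> V" "x = \<phi> c" using D CV by auto
    then show "x \<in> ?T"
    proof cases
      case 1
      then have "x = x + \<phi> 0 \<and> x \<in> U \<and> 0 \<in> V" using subspace_0[OF sub(2)] by simp
      then show ?thesis by blast
    next
      case 2
      then have "x = 0 + \<phi> c \<and> 0 \<in> U \<and> c \<in> V" using subspace_0[OF sub(1)] by simp
      then show ?thesis by blast
    qed
  qed
  have "dim ?T = card (D \<union> \<phi> ` C)" using basis_card_eq_dim[OF DT sp ind] by simp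
  also have "\<dots> = card D + card C"
    using finD finC disj inj by (simp add: card_Un_disjoint card_image)
  also have "card C = card B' - card B" using B'(1) finB by (simp add: C_def card_Diff_subset)
  also have "card B' = dim V" using basis_card_eq_dim[OF B'(2,4,3)] by simp
  finally have "dim ?T = dim U + (dim V - dim W)" using B D by simp
  moreover have "dim W \<le> dim V"
    using B(4) basis_card_eq_dim[OF B'(2,4,3)] card_mono[OF finB' B'(1)] by simp
  ultimately show ?thesis by simp
qed

lemma subset_dim_eq_imp_eq:
  assumes "subspace T" "T \<subseteq> S" "finite X" "S \<subseteq> span X" "dim S \<le> dim T"
  shows "T = S"
proof -
  obtain B where B: "B \<subseteq> T" "independent B" "T \<subseteq> span B" "card B = dim T"
    by (rule basis_exists)
  obtain B' where B': "B \<subseteq> B'" "B' \<subseteq> S" "independent B'" "S \<subseteq> span B'"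
    using maximal_independent_subset_extend[OF subset_trans[OF B(1) assms(2)] B(2)] by blast
  have "finite B'" using independent_span_bound[OF assms(3) B'(3)] B'(2) assms(4) by auto
  then have "B = B'"
    using B(4) basis_card_eq_dim[OF B'(2,4,3)] assms(5) B'(1) by (intro card_seteq) auto
  then show ?thesis using span_subspace[OF B(1,3) assms(1)] B' assms(2) by auto
qed

text \<open>Applying such a projection replaces membership in \<open>J\<close>, in particular congruence modulo an ideal,
  by the vanishing of coordinates.\<close>

lemma projection_with_kernel:
  assumes "subspace J"
  obtains \<pi> where "Vector_Spaces.linear scale scale \<pi>" "\<And>x. x - \<pi> x \<in> J" "\<And>x. \<pi> x = 0 \<longleftrightarrow> x \<in> J"
proof -
  obtain B where B: "B \<subseteq> J" "independent B" "J \<subseteq> span B" "card B = dim J"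
    by (rule basis_exists)
  obtain B' where B': "B \<subseteq> B'" "B' \<subseteq> UNIV" "independent B'" "UNIV \<subseteq> span B'"
    by (rule maximal_independent_subset_extend[OF subset_UNIV B(2)])
  have vp: "vector_space_pair scale scale" by unfold_locales
  obtain \<pi> where \<pi>: "Vector_Spaces.linear scale scale \<pi>" "\<forall>x\<in>B'. \<pi> x = (if x \<in> B then 0 else x)"
    using vector_space_pair.linear_independent_extend[OF vp B'(3), of "\<lambda>x. if x \<in> B then 0 else x"] by metis
  interpret \<pi>: Vector_Spaces.linear scale scale \<pi> by (fact \<pi>(1))
  have 1: "x - \<pi> x \<in> J" for x
  proof -
    have "x \<in> span B'" using B' by auto
    then show ?thesis
    proof (induction rule: span_induct_alt)
      case base
      then show ?case using subspace_0[OF assms] by simp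
    next
      case (step c x y)
      have "x - \<pi> x \<in> J" using \<pi>(2) step(1) B(1) subspace_0[OF assms] by auto
      then have "scale c (x - \<pi> x) + (y - \<pi> y) \<in> J"
        using subspace_add[OF assms] subspace_scale[OF assms] step(2) by auto
      then show ?case by (simp add: \<pi>.add \<pi>.scale scale_right_diff_distrib algebra_simps)
    qed
  qed
  have 2: "\<pi> x = 0" if "x \<in> J" for x
  proof (rule \<pi>.eq_0_on_span)
    show "x \<in> span B" using B(3) that by auto
    show "\<pi> b = 0" if "b \<in> B" for b using \<pi>(2) B'(1) that by auto
  qed
  show ?thesis
  proof (rule that[OF \<pi>(1) 1])
    show "\<pi> x = 0 \<longleftrightarrow> x \<in> J" for x
    proof
      assume "\<pi> x = 0"
      then show "x \<in> J" using 1[of x] by simp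
    qed (fact 2)
  qed
qed

end

section \<open>The graded polynomial ring\<close>

definition smul :: "'k::field \<Rightarrow> ('n::finite, 'k) mpol \<Rightarrow> ('n, 'k) mpol" where
  "smul c p = Poly_Mapping.single 0 c * p"

lemma module_times: "module ((*) :: 'r::comm_ring_1 \<Rightarrow> 'r \<Rightarrow> 'r)"
  by (rule module.intro) (rule distrib_left distrib_right mult.assoc[symmetric] mult_1_left)+

interpretation ideal: module "(*) :: 'r::comm_ring_1 \<Rightarrow> 'r \<Rightarrow> 'r"
  by (rule module_times)

(* As a default rewrite rule a * (b * x) = a * b * x would loop against mult.assoc. *)
declare ideal.scale_scale [simp del]

lemma vector_space_smul:
  "vector_space (smul :: 'k::field \<Rightarrow> ('n::finite, 'k) mpol \<Rightarrow> ('n, 'k) mpol)"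
  by (rule vector_space.intro) (simp_all add: smul_def distrib_left distrib_right single_add mult_single flip: mult.assoc)

interpretation mpol: vector_space "smul :: 'k::field \<Rightarrow> ('n::finite, 'k) mpol \<Rightarrow> ('n, 'k) mpol"
  by (rule vector_space_smul)

lemma lookup_smul [simp]: "Poly_Mapping.lookup (smul c p) m = c * Poly_Mapping.lookup p m"
  unfolding smul_def mult_map_scale_conv_mult[symmetric]
  by (simp add: Poly_Mapping.map.rep_eq when_def)

lemma mult_smul: "p * smul c q = smul c (p * q)" "smul c q * p = smul c (q * p)"
  by (simp_all add: smul_def ac_simps)

lemma linear_mult: "Vector_Spaces.linear smul smul ((*) (p :: ('n::finite, 'k::field) mpol))"
  by unfold_locales (simp_all add: distrib_left mult_smul)

lemma ideal_imp_subspace: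
  "is_ideal J \<Longrightarrow> mpol.subspace (J :: ('n::finite, 'k::field) mpol set)"
  unfolding mpol.subspace_def smul_def by (auto simp: ideal.subspace_def)

lemma mpol_eq_sum_single:
  "f = (\<Sum>m\<in>Poly_Mapping.keys f. Poly_Mapping.single m (Poly_Mapping.lookup f m))"
  by (rule poly_mapping_eqI)
     (simp add: lookup_sum lookup_single when_def in_keys_iff)

lemma monom_deg_add: "monom_deg (a + b) = monom_deg a + monom_deg b"
  by (simp add: monom_deg_def lookup_add sum.distrib)

lemma monom_deg_single [simp]: "monom_deg (Poly_Mapping.single v c) = c"
  by (simp add: monom_deg_def lookup_single when_def)

lemma monom_deg_zero [simp]: "monom_deg 0 = 0"
  by (simp add: monom_deg_def)

lemma forms_iff: "f \<in> forms i \<longleftrightarrow> (\<forall>m. Poly_Mapping.lookup f m \<noteq> 0 \<longrightarrow> monom_deg m = i)"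
  by (auto simp: forms_def in_keys_iff)

lemma subspace_forms: "mpol.subspace (forms i)"
  unfolding mpol.subspace_def by (auto simp: forms_iff lookup_add) (metis add_0)

lemma single_in_forms: "monom_deg m = i \<Longrightarrow> Poly_Mapping.single m c \<in> forms i"
  by (auto simp: forms_iff lookup_single when_def)

lemma mult_in_forms: "f \<in> forms a \<Longrightarrow> g \<in> forms b \<Longrightarrow> f * g \<in> forms (a + b)"
  using keys_mult[of f g] by (fastforce simp: forms_def monom_deg_add)

lemma mult_in_forms_diff: "f \<in> forms a \<Longrightarrow> g \<in> forms (i - a) \<Longrightarrow> a \<le> i \<Longrightarrow> f * g \<in> forms i"
  using mult_in_forms[of f a g "i - a"] by simp

lemma linear_form_in_forms: "linear_form a \<in> forms 1"
  unfolding linear_form_def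
  by (intro mpol.subspace_sum[OF subspace_forms] single_in_forms) simp

definition hom_part :: "nat \<Rightarrow> ('n::finite, 'k::field) mpol \<Rightarrow> ('n, 'k) mpol" where
  "hom_part i f = (\<Sum>m\<in>{m \<in> Poly_Mapping.keys f. monom_deg m = i}. Poly_Mapping.single m (Poly_Mapping.lookup f m))"

lemma lookup_hom_part: "Poly_Mapping.lookup (hom_part i f) m = (if monom_deg m = i then Poly_Mapping.lookup f m else 0)"
  by (auto simp: hom_part_def lookup_sum lookup_single when_def in_keys_iff)

lemma hom_part_in_forms: "hom_part i f \<in> forms i"
  by (simp add: forms_iff lookup_hom_part)

lemma hom_part_sum: "hom_part i (sum f A) = (\<Sum>x\<in>A. hom_part i (f x))"
  by (rule poly_mapping_eqI) (simp add: lookup_hom_part lookup_sum)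

lemma hom_part_form: "f \<in> forms e \<Longrightarrow> hom_part i f = (if i = e then f else 0)"
  by (rule poly_mapping_eqI) (auto simp: lookup_hom_part forms_iff)

lemma hom_part_mult:
  assumes "F \<in> forms d"
  shows "hom_part i (F * g) = (if d \<le> i then F * hom_part (i - d) g else 0)"
proof -
  let ?s = "\<lambda>m. Poly_Mapping.single m (Poly_Mapping.lookup g m)"
  have "hom_part i (F * g) = (\<Sum>m\<in>Poly_Mapping.keys g. hom_part i (F * ?s m))"
    by (subst mpol_eq_sum_single[of g]) (simp add: sum_distrib_left hom_part_sum)
  also have "\<dots> = (\<Sum>m\<in>Poly_Mapping.keys g. if d \<le> i then F * hom_part (i - d) (?s m) else 0)"
  proof (rule sum.cong)
    fix m
    have "?s m \<in> forms (monom_deg m)" by (simp add: single_in_forms)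
    then show "hom_part i (F * ?s m) = (if d \<le> i then F * hom_part (i - d) (?s m) else 0)"
      using hom_part_form[OF mult_in_forms[OF assms], of "?s m" "monom_deg m" i]
        hom_part_form[of "?s m" "monom_deg m" "i - d"] by auto
  qed simp
  also have "\<dots> = (if d \<le> i then F * hom_part (i - d) (\<Sum>m\<in>Poly_Mapping.keys g. ?s m) else 0)"
    by (simp add: hom_part_sum sum_distrib_left)
  finally show ?thesis using mpol_eq_sum_single[of g] by simp
qed

lemma ideal_gen_image_sum:
  assumes "finite S" "f \<in> ideal_gen (F ` S)"
  obtains h where "f = (\<Sum>j\<in>S. F j * h j)"
proof -
  from assms(2) have "\<exists>h. f = (\<Sum>j\<in>S. F j * h j)"
  proof (induction rule: ideal.span_induct_alt)
    case base
    show ?case by (rule exI[of _ "\<lambda>_. 0"]) simp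
  next
    case (step c x y)
    then obtain h s where h: "y = (\<Sum>j\<in>S. F j * h j)" and s: "s \<in> S" "x = F s" by auto
    have "(\<Sum>j\<in>S. F j * (h j + (if j = s then c else 0)))
        = y + (\<Sum>j\<in>S. if j = s then F j * c else 0)"
      unfolding h sum.distrib[symmetric] by (rule sum.cong) (simp_all add: distrib_left)
    also have "\<dots> = c * x + y" using s assms(1) by (simp add: mult.commute add.commute)
    finally show ?case by metis
  qed
  then show ?thesis using that by blast
qed

text \<open>Taking the component of degree \<open>i\<close> of any expression of \<open>f\<close> by the generators makes all cofactors
  homogeneous, and the generators of degree greater than \<open>i\<close> drop out.\<close>

lemma form_in_ideal_gen:
  assumes "finite S" "\<And>j. j \<in> S \<Longrightarrow> F j \<in> forms (d j)" "f \<in> ideal_gen (F ` S)" "f \<in> forms i"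
  obtains g where "\<And>j. g j \<in> forms (i - d j)"
    and "f = (\<Sum>j\<in>{j\<in>S. d j \<le> i}. F j * g j)"
proof -
  obtain h where h: "f = (\<Sum>j\<in>S. F j * h j)"
    using ideal_gen_image_sum[OF assms(1,3)] .
  have "f = hom_part i f" using hom_part_form[OF assms(4), of i] by simp
  also have "\<dots> = (\<Sum>j\<in>S. if d j \<le> i then F j * hom_part (i - d j) (h j) else 0)"
    unfolding h hom_part_sum by (rule sum.cong) (simp_all add: hom_part_mult assms(2))
  also have "\<dots> = (\<Sum>j\<in>{j\<in>S. d j \<le> i}. F j * hom_part (i - d j) (h j))"
    using assms(1) by (simp add: sum.If_cases Int_def)
  finally show ?thesis using that[of "\<lambda>j. hom_part (i - d j) (h j)"] hom_part_in_forms by blast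
qed

section \<open>Hilbert functions\<close>

lemma finite_monomials: "finite {m :: 'n::finite \<Rightarrow>\<^sub>0 nat. monom_deg m = i}"
proof -
  have "{m :: 'n \<Rightarrow>\<^sub>0 nat. monom_deg m = i} \<subseteq> Poly_Mapping.lookup -` (Pi UNIV (\<lambda>_. {..i}))"
    using member_le_sum[where A = "UNIV :: 'n set" and f = "Poly_Mapping.lookup m" for m :: "'n \<Rightarrow>\<^sub>0 nat"]
    by (force simp: monom_deg_def)
  moreover have "finite (Pi UNIV (\<lambda>_::'n. {..i}))"
    using finite_PiE[of "UNIV :: 'n set" "\<lambda>_. {..i}"] unfolding PiE_UNIV_domain by simp
  then have "finite (Poly_Mapping.lookup -` (Pi UNIV (\<lambda>_::'n. {..i})) :: ('n \<Rightarrow>\<^sub>0 nat) set)"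
    by (rule finite_vimageI) (rule injI, rule poly_mapping_eqI, simp)
  ultimately show ?thesis by (rule finite_subset)
qed

abbreviation monomial :: "('n::finite \<Rightarrow>\<^sub>0 nat) \<Rightarrow> ('n, 'k::field) mpol" where
  "monomial m \<equiv> Poly_Mapping.single m 1"

lemma smul_single: "smul c (Poly_Mapping.single m a) = Poly_Mapping.single m (c * a)"
  by (simp add: smul_def mult_single)

lemma forms_subset_span: "forms i \<subseteq> mpol.span (monomial ` {m. monom_deg m = i})"
proof
  fix f :: "('a, 'b) mpol" assume "f \<in> forms i"
  then have "(\<Sum>m\<in>Poly_Mapping.keys f. smul (Poly_Mapping.lookup f m) (monomial m)) \<in> mpol.span (monomial ` {m. monom_deg m = i})"
    by (intro mpol.span_sum mpol.span_scale mpol.span_base) (auto simp: forms_def)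
  then show "f \<in> mpol.span (monomial ` {m. monom_deg m = i})"
    using mpol_eq_sum_single[of f] by (simp add: smul_single)
qed

lemma dim_forms: "mpol.dim (forms i :: ('n::finite, 'k::field) mpol set)
    = card {m :: 'n \<Rightarrow>\<^sub>0 nat. monom_deg m = i}"
proof (rule mpol.dim_unique[OF _ forms_subset_span])
  let ?M = "{m :: 'n \<Rightarrow>\<^sub>0 nat. monom_deg m = i}"
  have inj: "inj_on (monomial :: _ \<Rightarrow> ('n, 'k) mpol) ?M"
    by (rule inj_onI) (metis lookup_single_eq lookup_single_not_eq zero_neq_one)
  show "card ((monomial :: _ \<Rightarrow> ('n, 'k) mpol) ` ?M) = card ?M" by (rule card_image[OF inj])
  show "monomial ` ?M \<subseteq> (forms i :: ('n, 'k) mpol set)" by (auto intro: single_in_forms)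
  show "\<not> mpol.dependent ((monomial :: _ \<Rightarrow> ('n, 'k) mpol) ` ?M)"
  proof -
    have "u (monomial m) = 0"
      if u: "(\<Sum>v\<in>monomial ` ?M. smul (u v) v) = (0 :: ('n, 'k) mpol)" and m: "m \<in> ?M" for u m
    proof -
      have "0 = Poly_Mapping.lookup (\<Sum>m\<in>?M. smul (u (monomial m)) (monomial m)) m"
        using u by (simp add: sum.reindex[OF inj])
      also have "\<dots> = u (monomial m)"
        using m by (simp add: lookup_sum smul_single lookup_single when_def finite_monomials)
      finally show ?thesis by simp
    qed
    then show ?thesis by (auto simp: mpol.dependent_finite finite_monomials)
  qed
qed

text \<open>The Hilbert series of the quotient by \<open>J\<close>, with integer coefficients so that it can be multiplied by
  \<open>1 - t\<close>.\<close>

definition hilbert :: "('n::finite, 'k::field) mpol set \<Rightarrow> int fps" where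
  "hilbert J = Abs_fps (\<lambda>i. int (mpol.dim (forms i :: ('n, 'k) mpol set))
                            - int (mpol.dim (J \<inter> forms i)))"

text \<open>A monomial in the variables \<open>insert v S\<close> either avoids \<open>v\<close> or is \<open>v\<close> times a monomial of smaller
  degree, so each new variable contributes one factor \<open>1 / (1 - t)\<close>.\<close>

lemma monomial_series:
  assumes "finite S"
  shows "(1 - fps_X) ^ card S
    * Abs_fps (\<lambda>i. int (card {m :: 'n::finite \<Rightarrow>\<^sub>0 nat. Poly_Mapping.keys m \<subseteq> S \<and> monom_deg m = i})) = 1"
  using assms
proof (induction S)
  case empty
  have "{m :: 'n \<Rightarrow>\<^sub>0 nat. Poly_Mapping.keys m = {} \<and> monom_deg m = i} = (if i = 0 then {0} else {})" for i
    by auto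
  then have "int (card {m :: 'n \<Rightarrow>\<^sub>0 nat. Poly_Mapping.keys m \<subseteq> {} \<and> monom_deg m = i}) = (if i = 0 then 1 else 0)" for i
    by simp
  then show ?case by (intro fps_ext) simp
next
  case (insert v S)
  let ?M = "\<lambda>S i. {m :: 'n \<Rightarrow>\<^sub>0 nat. Poly_Mapping.keys m \<subseteq> S \<and> monom_deg m = i}"
  let ?H = "\<lambda>S. Abs_fps (\<lambda>i. int (card (?M S i)))"
  have fin: "finite (?M S i)" for S i
    using finite_monomials[of i] by (rule finite_subset[rotated]) auto
  have 0: "?M (insert v S) 0 = ?M S 0"
  proof -
    have "m = 0" if "monom_deg m = 0" for m :: "'n \<Rightarrow>\<^sub>0 nat"
      using that by (intro poly_mapping_eqI) (simp add: monom_deg_def)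
    then have "?M A 0 = {0}" for A by fastforce
    then show ?thesis by simp
  qed
  have Suc: "card (?M (insert v S) (Suc i)) = card (?M S (Suc i)) + card (?M (insert v S) i)" for i
  proof -
    let ?f = "\<lambda>m. m + Poly_Mapping.single v (1::nat)"
    have split: "?M (insert v S) (Suc i) = ?M S (Suc i) \<union> ?f ` ?M (insert v S) i"
    proof (intro equalityI subsetI)
      fix m assume m: "m \<in> ?M (insert v S) (Suc i)"
      show "m \<in> ?M S (Suc i) \<union> ?f ` ?M (insert v S) i"
      proof (cases "Poly_Mapping.lookup m v = 0")
        case True
        then show ?thesis using m by (auto simp: in_keys_iff)
      next
        case False
        let ?m = "m - Poly_Mapping.single v (1::nat)"
        have eq: "?f ?m = m"
          using False by (intro poly_mapping_eqI) (auto simp: lookup_add lookup_minus lookup_single when_def)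
        then have "monom_deg ?m + 1 = Suc i" using m monom_deg_add[of ?m "Poly_Mapping.single v 1"] by simp
        moreover have "Poly_Mapping.keys ?m \<subseteq> insert v S"
        proof
          fix x assume "x \<in> Poly_Mapping.keys ?m"
          then have "x \<in> Poly_Mapping.keys m" by (auto simp: in_keys_iff lookup_minus)
          then show "x \<in> insert v S" using m by auto
        qed
        ultimately have "?m \<in> ?M (insert v S) i" by simp
        then show ?thesis using eq by (metis (no_types, lifting) UnI2 image_eqI)
      qed
    next
      fix m assume m: "m \<in> ?M S (Suc i) \<union> ?f ` ?M (insert v S) i"
      then show "m \<in> ?M (insert v S) (Suc i)"
      proof
        assume "m \<in> ?f ` ?M (insert v S) i"
        then obtain m' where m': "m' \<in> ?M (insert v S) i" "m = ?f m'" by auto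
        have "Poly_Mapping.keys m \<subseteq> insert v S"
          using m'(1) keys_add[of m' "Poly_Mapping.single v 1"] unfolding m'(2) by auto
        then show ?thesis using m' by (simp add: monom_deg_add)
      qed auto
    qed
    have disj: "?M S (Suc i) \<inter> ?f ` ?M (insert v S) i = {}"
      using insert.hyps(2) by (auto simp: subset_iff in_keys_iff lookup_add)
    have "card (?f ` ?M (insert v S) i) = card (?M (insert v S) i)"
      by (intro card_image inj_onI) simp
    then show ?thesis unfolding split using disj fin by (subst card_Un_disjoint) auto
  qed
  have "(1 - fps_X) * ?H (insert v S) = ?H S"
  proof (rule fps_ext)
    fix i
    show "fps_nth ((1 - fps_X) * ?H (insert v S)) i = fps_nth (?H S) i"
      using 0 Suc by (cases i) (simp_all add: left_diff_distrib)
  qed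
  then have "(1 - fps_X) ^ card (insert v S) * ?H (insert v S) = (1 - fps_X) ^ card S * ?H S"
    using insert.hyps by (simp add: mult.assoc mult.left_commute)
  then show ?case using insert.IH by simp
qed

lemma hilbert_zero:
  "(1 - fps_X) ^ card (UNIV :: 'n set) * hilbert ({0} :: ('n::finite, 'k::field) mpol set) = 1"
proof -
  have "{0} \<inter> forms i = ({0} :: ('n, 'k) mpol set)" for i
    using mpol.subspace_0[OF subspace_forms] by auto
  moreover have "mpol.dim ({0} :: ('n, 'k) mpol set) = 0"
    using mpol.dim_le_card[of "{0} :: ('n, 'k) mpol set" "{}"] by simp
  ultimately have "hilbert ({0} :: ('n, 'k) mpol set)
      = Abs_fps (\<lambda>i. int (card {m :: 'n \<Rightarrow>\<^sub>0 nat. Poly_Mapping.keys m \<subseteq> UNIV \<and> monom_deg m = i}))"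
    by (simp add: hilbert_def dim_forms)
  then show ?thesis using monomial_series[of "UNIV :: 'n set"] by simp
qed

lemma dim_mult_mod_ideal:
  fixes F :: "('n::finite, 'k::field) mpol"
  assumes J: "is_ideal J" and F: "F \<in> forms d"
    and nzd: "\<And>g. g \<in> forms e \<Longrightarrow> F * g \<in> J \<Longrightarrow> g \<in> J"
  shows "mpol.dim {u + F * v | u v. u \<in> J \<inter> forms (e + d) \<and> v \<in> forms e} + mpol.dim (J \<inter> forms e)
    = mpol.dim (J \<inter> forms (e + d)) + mpol.dim (forms e :: ('n, 'k) mpol set)"
proof (rule mpol.dim_sum_image[OF linear_mult])
  show "mpol.subspace (J \<inter> forms (e + d))" "mpol.subspace (J \<inter> forms e)"
    by (intro mpol.subspace_inter ideal_imp_subspace[OF J] subspace_forms)+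
  show "mpol.subspace (forms e)" by (fact subspace_forms)
  show "J \<inter> forms e \<subseteq> forms e" by simp
  show "forms e \<subseteq> mpol.span (monomial ` {m. monom_deg m = e})" by (fact forms_subset_span)
  show "J \<inter> forms (e + d) \<subseteq> mpol.span (monomial ` {m. monom_deg m = e + d})"
    using forms_subset_span by blast
  show "finite (monomial ` {m. monom_deg m = e} :: ('n, 'k) mpol set)"
    "finite (monomial ` {m. monom_deg m = e + d} :: ('n, 'k) mpol set)"
    by (intro finite_imageI finite_monomials)+
  show "F * v \<in> J \<inter> forms (e + d) \<longleftrightarrow> v \<in> J \<inter> forms e" if "v \<in> forms e" for v
    using that nzd mult_in_forms[OF F that] ideal.subspace_scale[OF J, of v F]
    by (auto simp: add.commute)
qed

lemma hilbert_step:
  fixes F :: "nat \<Rightarrow> ('n::finite, 'k::field) mpol"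
  assumes F: "\<And>j. j \<in> {1..r} \<Longrightarrow> F j \<in> forms (d j)" and r: "r \<ge> 1"
    and nzd: "\<And>g. F r * g \<in> ideal_gen (F ` {1..<r}) \<Longrightarrow> g \<in> ideal_gen (F ` {1..<r})"
  shows "hilbert (ideal_gen (F ` {1..r})) = (1 - fps_X ^ d r) * hilbert (ideal_gen (F ` {1..<r}))"
proof (rule fps_ext)
  fix i
  let ?J = "ideal_gen (F ` {1..<r})" and ?J' = "ideal_gen (F ` {1..r})"
  have JJ': "?J \<subseteq> ?J'" by (rule ideal.span_mono) auto
  have Fr: "F r \<in> ?J'" using r by (intro ideal.span_base) auto
  have idx: "{1..r} = insert r {1..<r}" using r by auto
  have decomp: "\<exists>u v. u \<in> ?J \<inter> forms i \<and> v \<in> forms (i - d r) \<and> f = u + (if d r \<le> i then F r * v else 0)"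
    if f: "f \<in> ?J'" "f \<in> forms i" for f
  proof -
    obtain g where g: "\<And>j. g j \<in> forms (i - d j)" and fg: "f = (\<Sum>j\<in>{j\<in>{1..r}. d j \<le> i}. F j * g j)"
      using form_in_ideal_gen[OF _ _ f, of d] F by auto
    let ?u = "\<Sum>j\<in>{j\<in>{1..<r}. d j \<le> i}. F j * g j"
    have "?u \<in> ?J"
    proof (rule ideal.span_sum)
      fix j assume "j \<in> {j \<in> {1..<r}. d j \<le> i}"
      then have "F j \<in> ?J" by (intro ideal.span_base) auto
      then show "F j * g j \<in> ?J" by (subst mult.commute) (rule ideal.span_scale)
    qed
    moreover have "?u \<in> forms i"
      using F g by (intro mpol.subspace_sum[OF subspace_forms] mult_in_forms_diff) auto
    moreover have "f = ?u + (if d r \<le> i then F r * g r else 0)"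
    proof (cases "d r \<le> i")
      case True
      then have "{j\<in>{1..r}. d j \<le> i} = insert r {j\<in>{1..<r}. d j \<le> i}" unfolding idx by auto
      then show ?thesis using True by (simp add: fg add.commute)
    next
      case False
      then have "{j\<in>{1..r}. d j \<le> i} = {j\<in>{1..<r}. d j \<le> i}" unfolding idx by auto
      then show ?thesis using False fg by simp
    qed
    ultimately show ?thesis using g by blast
  qed
  show "fps_nth (hilbert ?J') i = fps_nth ((1 - fps_X ^ d r) * hilbert ?J) i"
  proof (cases "d r \<le> i")
    case True
    have "{u + F r * v | u v. u \<in> ?J \<inter> forms i \<and> v \<in> forms (i - d r)} = ?J' \<inter> forms i"
    proof (intro equalityI subsetI)
      fix f assume "f \<in> {u + F r * v | u v. u \<in> ?J \<inter> forms i \<and> v \<in> forms (i - d r)}"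
      then obtain u v where uv: "f = u + F r * v" "u \<in> ?J" "u \<in> forms i" "v \<in> forms (i - d r)" by auto
      have "F r * v \<in> forms i" using F r uv True by (intro mult_in_forms_diff) auto
      then have "f \<in> forms i" using uv mpol.subspace_add[OF subspace_forms] by auto
      moreover have "f \<in> ?J'"
        unfolding uv(1) mult.commute[of "F r"] using uv JJ' Fr
        by (intro ideal.span_add ideal.span_scale) auto
      ultimately show "f \<in> ?J' \<inter> forms i" by simp
    next
      fix f assume "f \<in> ?J' \<inter> forms i"
      then show "f \<in> {u + F r * v | u v. u \<in> ?J \<inter> forms i \<and> v \<in> forms (i - d r)}"
        using decomp[of f] True by auto
    qed
    moreover have "mpol.dim {u + F r * v | u v. u \<in> ?J \<inter> forms (i - d r + d r) \<and> v \<in> forms (i - d r)}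
        + mpol.dim (?J \<inter> forms (i - d r))
      = mpol.dim (?J \<inter> forms (i - d r + d r)) + mpol.dim (forms (i - d r) :: ('n, 'k) mpol set)"
      using F r nzd by (intro dim_mult_mod_ideal) auto
    ultimately show ?thesis using True
      by (simp add: hilbert_def left_diff_distrib fps_X_power_mult_nth)
  next
    case False
    then have "?J' \<inter> forms i = ?J \<inter> forms i" using decomp JJ' by auto
    then show ?thesis using False
      by (simp add: hilbert_def left_diff_distrib fps_X_power_mult_nth)
  qed
qed

lemma hilbert_regular_sequence:
  fixes F :: "nat \<Rightarrow> ('n::finite, 'k::field) mpol"
  assumes F: "\<And>j. j \<in> {1..r} \<Longrightarrow> F j \<in> forms (d j)"
    and nzd: "\<And>j g. j \<in> {1..r} \<Longrightarrow> F j * g \<in> ideal_gen (F ` {1..<j}) \<Longrightarrow> g \<in> ideal_gen (F ` {1..<j})"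
  shows "(1 - fps_X) ^ card (UNIV :: 'n set) * hilbert (ideal_gen (F ` {1..r}))
      = (\<Prod>j=1..r. 1 - fps_X ^ d j)"
  using assms
proof (induction r)
  case 0
  then show ?case using hilbert_zero[where 'n = 'n and 'k = 'k] by simp
next
  case (Suc r)
  have "hilbert (ideal_gen (F ` {1..Suc r})) = (1 - fps_X ^ d (Suc r)) * hilbert (ideal_gen (F ` {1..<Suc r}))"
    by (rule hilbert_step) (use Suc.prems in auto)
  also have "{1..<Suc r} = {1..r}" by auto
  finally show ?case using Suc by (simp add: mult.left_commute mult.commute)
qed

text \<open>For one form less than there are variables, cancelling \<open>(1 - t)\<^sup>r\<close> leaves
  \<open>(1 - t) H(t)\<close> as the product of the polynomials \<open>1 + t + \<dots> + t\<^bsup>d j - 1\<^esup>\<close>, of degree at most \<open>e\<close>.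
  So its coefficient at \<open>e + 1\<close>, the difference of the two values of the Hilbert function, vanishes.\<close>

lemma hilbert_stable:
  fixes F :: "nat \<Rightarrow> ('n::finite, 'k::field) mpol"
  assumes F: "\<And>j. j \<in> {1..r} \<Longrightarrow> F j \<in> forms (d j)"
    and nzd: "\<And>j g. j \<in> {1..r} \<Longrightarrow> F j * g \<in> ideal_gen (F ` {1..<j}) \<Longrightarrow> g \<in> ideal_gen (F ` {1..<j})"
    and r: "Suc r = card (UNIV :: 'n set)"
    and e: "e = (\<Sum>j=1..r. d j - 1)"
  shows "fps_nth (hilbert (ideal_gen (F ` {1..r}))) (Suc e) = fps_nth (hilbert (ideal_gen (F ` {1..r}))) e"
proof -
  let ?H = "hilbert (ideal_gen (F ` {1..r}))"
  define P :: "nat \<Rightarrow> int poly" where "P = (\<lambda>j. \<Sum>l<d j. monom 1 l)"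
  have P: "1 - fps_X ^ d j = (1 - fps_X) * fps_of_poly (P j)" for j
  proof -
    have "fps_of_poly (P j) = (\<Sum>l<d j. fps_X ^ l)"
      by (simp add: P_def fps_of_poly_sum fps_of_poly_monom')
    then show ?thesis by (simp add: one_diff_power_eq)
  qed
  have "(1 - fps_X) ^ r * ((1 - fps_X) * ?H) = (1 - fps_X) ^ Suc r * ?H"
    by (simp only: power_Suc2 mult.assoc)
  also have "\<dots> = (\<Prod>j=1..r. 1 - fps_X ^ d j)"
    using hilbert_regular_sequence[of r F d, OF F nzd] unfolding r[symmetric] .
  also have "\<dots> = (1 - fps_X) ^ r * fps_of_poly (\<Prod>j=1..r. P j)"
    by (simp add: P prod.distrib fps_of_poly_prod)
  finally have eq: "(1 - fps_X) * ?H = fps_of_poly (\<Prod>j=1..r. P j)"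
  proof (rule mult_left_cancel[THEN iffD1, rotated])
    have "fps_nth (1 - fps_X :: int fps) 0 \<noteq> 0" by simp
    then have "(1 - fps_X :: int fps) \<noteq> 0" by (metis fps_zero_nth)
    then show "(1 - fps_X :: int fps) ^ r \<noteq> 0" by simp
  qed
  have "degree (P j) \<le> d j - 1" for j
    unfolding P_def by (intro degree_sum_le) (auto intro: order_trans[OF degree_monom_le])
  then have "degree (\<Prod>j=1..r. P j) \<le> e"
    unfolding e by (intro order_trans[OF degree_prod_sum_le] sum_mono) auto
  then have "fps_nth ((1 - fps_X) * ?H) (Suc e) = 0"
    unfolding eq by (simp add: coeff_eq_0)
  then show ?thesis by (simp add: left_diff_distrib)
qed

section \<open>Polynomial functions\<close>

lemma eval_superset:
  assumes "finite A" "Poly_Mapping.keys p \<subseteq> A"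
  shows "eval p a = (\<Sum>m\<in>A. Poly_Mapping.lookup p m * (\<Prod>i\<in>UNIV. a i ^ Poly_Mapping.lookup m i))"
  unfolding eval_def using assms by (intro sum.mono_neutral_left) (auto simp: in_keys_iff)

lemma eval_add: "eval (p + q) a = eval p a + eval q a"
proof -
  let ?A = "Poly_Mapping.keys p \<union> Poly_Mapping.keys q"
  have "Poly_Mapping.keys (p + q) \<subseteq> ?A" by (rule keys_add)
  then show ?thesis
    by (simp add: eval_superset[of ?A] lookup_add distrib_right sum.distrib)
qed

lemma eval_single: "eval (Poly_Mapping.single m c) a = c * (\<Prod>i\<in>UNIV. a i ^ Poly_Mapping.lookup m i)"
  by (subst eval_superset[of "{m}"]) auto

lemma eval_zero [simp]: "eval 0 a = 0"
  by (simp add: eval_def)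

lemma eval_sum: "eval (sum f A) a = (\<Sum>x\<in>A. eval (f x) a)"
  by (induction A rule: infinite_finite_induct) (simp_all add: eval_add)

lemma eval_mult: "eval (p * q) a = eval p a * eval q a"
proof -
  have "p * q = (\<Sum>m\<in>Poly_Mapping.keys p. Poly_Mapping.single m (Poly_Mapping.lookup p m))
      * (\<Sum>m\<in>Poly_Mapping.keys q. Poly_Mapping.single m (Poly_Mapping.lookup q m))"
    using mpol_eq_sum_single[of p] mpol_eq_sum_single[of q] by simp
  also have "\<dots> = (\<Sum>m\<in>Poly_Mapping.keys p. \<Sum>m'\<in>Poly_Mapping.keys q. Poly_Mapping.single (m + m') (Poly_Mapping.lookup p m * Poly_Mapping.lookup q m'))"
    by (simp add: sum_product mult_single)
  finally have "eval (p * q) a = (\<Sum>m\<in>Poly_Mapping.keys p. \<Sum>m'\<in>Poly_Mapping.keys q.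
      eval (Poly_Mapping.single (m + m') (Poly_Mapping.lookup p m * Poly_Mapping.lookup q m')) a)"
    by (simp add: eval_sum)
  also have "\<dots> = eval p a * eval q a"
    unfolding eval_def[of p] eval_def[of q] sum_product
    by (simp add: eval_single lookup_add power_add prod.distrib mult_ac)
  finally show ?thesis .
qed

text \<open>Genericity concerns only the values at coefficient vectors of linear forms; working with functions
  turns products and compositions of polynomials into pointwise operations.\<close>

definition polyfuns :: "(('n::finite \<Rightarrow> 'k::field) \<Rightarrow> 'k) set" where
  "polyfuns = range eval"

lemma polyfuns_const: "(\<lambda>a. c) \<in> polyfuns"
  unfolding polyfuns_def by (rule range_eqI[of _ _ "Poly_Mapping.single 0 c"]) (simp add: eval_single fun_eq_iff)

lemma polyfuns_coordinate: "(\<lambda>a. a v) \<in> polyfuns"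
proof -
  have "eval (Poly_Mapping.single (Poly_Mapping.single v 1) 1) a = a v" for a :: "'a \<Rightarrow> 'b"
  proof -
    have "(\<Prod>i\<in>UNIV. a i ^ Poly_Mapping.lookup (Poly_Mapping.single v 1) i) = (\<Prod>i\<in>UNIV. if i = v then a i else 1)"
      by (rule prod.cong) (auto simp: lookup_single when_def)
    then show ?thesis by (simp add: eval_single)
  qed
  then show ?thesis unfolding polyfuns_def by (metis (no_types, lifting) ext range_eqI)
qed

lemma polyfuns_add: "f \<in> polyfuns \<Longrightarrow> g \<in> polyfuns \<Longrightarrow> (\<lambda>a. f a + g a) \<in> polyfuns"
  unfolding polyfuns_def by (auto simp flip: eval_add)

lemma polyfuns_mult: "f \<in> polyfuns \<Longrightarrow> g \<in> polyfuns \<Longrightarrow> (\<lambda>a. f a * g a) \<in> polyfuns"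
  unfolding polyfuns_def by (auto simp flip: eval_mult)

lemma polyfuns_uminus: "f \<in> polyfuns \<Longrightarrow> (\<lambda>a. - f a) \<in> polyfuns"
  using polyfuns_mult[OF polyfuns_const[of "-1"]] by auto

lemma polyfuns_diff: "f \<in> polyfuns \<Longrightarrow> g \<in> polyfuns \<Longrightarrow> (\<lambda>a. f a - g a) \<in> polyfuns"
  using polyfuns_add[OF _ polyfuns_uminus] by (auto simp: diff_conv_add_uminus simp del: add_uminus_conv_diff)

lemma polyfuns_sum: "(\<And>x. x \<in> A \<Longrightarrow> f x \<in> polyfuns) \<Longrightarrow> (\<lambda>a. \<Sum>x\<in>A. f x a) \<in> polyfuns"
  by (induction A rule: infinite_finite_induct) (auto intro: polyfuns_add polyfuns_const)

lemma polyfuns_prod: "(\<And>x. x \<in> A \<Longrightarrow> f x \<in> polyfuns) \<Longrightarrow> (\<lambda>a. \<Prod>x\<in>A. f x a) \<in> polyfuns"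
  by (induction A rule: infinite_finite_induct) (auto intro: polyfuns_mult polyfuns_const)

lemma polyfuns_power: "f \<in> polyfuns \<Longrightarrow> (\<lambda>a. f a ^ i) \<in> polyfuns"
  by (induction i) (auto intro: polyfuns_mult polyfuns_const)

lemma polyfuns_eval_compose:
  "(\<And>v. \<sigma> v \<in> polyfuns) \<Longrightarrow> (\<lambda>a. eval p (\<lambda>v. \<sigma> v a)) \<in> polyfuns"
  unfolding eval_def
  by (intro polyfuns_sum polyfuns_mult polyfuns_const polyfuns_prod polyfuns_power)

text \<open>Restriction to a parametrised curve reduces statements about several variables to univariate
  polynomials.\<close>

lemma polyfun_along_curve:
  fixes \<gamma> :: "'n::finite \<Rightarrow> 'k::field poly"
  assumes "f \<in> polyfuns"
  obtains q where "\<And>t. f (\<lambda>v. poly (\<gamma> v) t) = poly q t"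
proof -
  obtain p where "f = eval p" using assms by (auto simp: polyfuns_def)
  then have "f (\<lambda>v. poly (\<gamma> v) t)
      = poly (\<Sum>m\<in>Poly_Mapping.keys p. smult (Poly_Mapping.lookup p m) (\<Prod>v\<in>UNIV. \<gamma> v ^ Poly_Mapping.lookup m v)) t" for t
    by (simp add: eval_def poly_sum poly_prod)
  then show ?thesis by (rule that)
qed

lemma poly_nonroot:
  fixes q :: "'k::field poly"
  assumes "infinite (UNIV :: 'k set)" "q \<noteq> 0"
  obtains t where "poly q t \<noteq> 0"
  using poly_roots_finite[OF assms(2)] assms(1) by (metis (mono_tags, lifting) UNIV_eq_I mem_Collect_eq)

text \<open>Restricted to the line through \<open>a\<close> and \<open>b\<close> both functions become nonzero univariate polynomials, and
  their product has only finitely many roots.\<close>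

lemma polyfuns_common_nonzero:
  fixes f g :: "('n::finite \<Rightarrow> 'k::field) \<Rightarrow> 'k"
  assumes inf: "infinite (UNIV :: 'k set)" and fg: "f \<in> polyfuns" "g \<in> polyfuns"
    and nz: "f a \<noteq> 0" "g b \<noteq> 0"
  obtains c where "f c \<noteq> 0" "g c \<noteq> 0"
proof -
  let ?\<gamma> = "\<lambda>v. [:a v, b v - a v:]"
  obtain q where q: "\<And>t. f (\<lambda>v. poly (?\<gamma> v) t) = poly q t"
    using polyfun_along_curve[OF fg(1), of ?\<gamma>] by blast
  obtain r where r: "\<And>t. g (\<lambda>v. poly (?\<gamma> v) t) = poly r t"
    using polyfun_along_curve[OF fg(2), of ?\<gamma>] by blast
  have "poly q 0 \<noteq> 0" "poly r 1 \<noteq> 0" using q[of 0] r[of 1] nz by simp_all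
  then have "q * r \<noteq> 0" by auto
  then obtain t where "poly (q * r) t \<noteq> 0" using poly_nonroot[OF inf] by blast
  then have "f (\<lambda>v. poly (?\<gamma> v) t) \<noteq> 0" "g (\<lambda>v. poly (?\<gamma> v) t) \<noteq> 0"
    unfolding q r by simp_all
  then show ?thesis by (rule that)
qed

text \<open>Gaussian elimination over the ring of polynomial functions: the vectors \<open>v j a\<close>, with coordinates
  polynomial in \<open>a\<close>, are independent for general \<open>a\<close> unless they satisfy a relation whose coefficients are
  again polynomial in \<open>a\<close>.  Cross-multiplying instead of dividing by the pivot keeps all entries polynomial.\<close>

lemma generic_independence_or_relation:
  fixes v :: "'j \<Rightarrow> ('n::finite \<Rightarrow> 'k::field) \<Rightarrow> 'm \<Rightarrow> 'k"
  assumes inf: "infinite (UNIV :: 'k set)" and "finite S"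
    and "\<And>j m. j \<in> S \<Longrightarrow> (\<lambda>a. v j a m) \<in> polyfuns"
  shows "(\<exists>p\<in>polyfuns. (\<exists>a. p a \<noteq> 0) \<and>
            (\<forall>a. p a \<noteq> 0 \<longrightarrow> (\<forall>c. (\<forall>m. (\<Sum>j\<in>S. c j * v j a m) = 0) \<longrightarrow> (\<forall>j\<in>S. c j = 0))))
       \<or> (\<exists>c. (\<forall>j\<in>S. c j \<in> polyfuns) \<and> (\<exists>j\<in>S. \<exists>a. c j a \<noteq> 0) \<and>
            (\<forall>a m. (\<Sum>j\<in>S. c j a * v j a m) = 0))"
  using assms(2,3)
proof (induction S arbitrary: v)
  case empty
  show ?case by (rule disjI1, rule bexI[of _ "\<lambda>_. 1"]) (auto intro: polyfuns_const)
next
  case (insert s S)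
  show ?case
  proof (cases "\<forall>a m. v s a m = 0")
    case True
    let ?c = "\<lambda>j a. if j = s then 1 else 0"
    have "(\<Sum>j\<in>insert s S. ?c j a * v j a m) = 0" for a m
      using True by (intro sum.neutral) auto
    moreover have "?c j \<in> polyfuns" for j by (auto intro: polyfuns_const)
    ultimately show ?thesis
      by (intro disjI2 exI[of _ ?c]) (auto intro: polyfuns_const)
  next
    case False
    \<comment> \<open>The coordinate \<open>m0\<close> of \<open>v s\<close> is the pivot; it vanishes in all vectors of the family \<open>w\<close>.\<close>
    then obtain a1 m0 where a1: "v s a1 m0 \<noteq> 0" by auto
    let ?p = "\<lambda>a. v s a m0"
    define w where "w = (\<lambda>j a m. ?p a * v j a m - v j a m0 * v s a m)"
    have P: "(\<lambda>a. v j a m) \<in> polyfuns" if "j \<in> insert s S" for j m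
      using insert.prems that by blast
    have "(\<lambda>a. w j a m) \<in> polyfuns" if "j \<in> S" for j m
      unfolding w_def using P that by (intro polyfuns_diff polyfuns_mult) auto
    from insert.IH[of w, OF this] show ?thesis
    proof
      assume "\<exists>p\<in>polyfuns. (\<exists>a. p a \<noteq> 0) \<and>
            (\<forall>a. p a \<noteq> 0 \<longrightarrow> (\<forall>c. (\<forall>m. (\<Sum>j\<in>S. c j * w j a m) = 0) \<longrightarrow> (\<forall>j\<in>S. c j = 0)))"
      then obtain p a2 where p: "p \<in> polyfuns" "p a2 \<noteq> 0"
        and ind: "\<forall>a. p a \<noteq> 0 \<longrightarrow> (\<forall>c. (\<forall>m. (\<Sum>j\<in>S. c j * w j a m) = 0) \<longrightarrow> (\<forall>j\<in>S. c j = 0))"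
        by blast
      obtain a3 where "p a3 \<noteq> 0" "?p a3 \<noteq> 0"
        using polyfuns_common_nonzero[OF inf p(1) P[of s m0] p(2) a1] by auto
      moreover have "(\<lambda>a. p a * ?p a) \<in> polyfuns" using p P by (intro polyfuns_mult) auto
      moreover have "\<forall>j\<in>insert s S. c j = 0"
        if a: "p a * ?p a \<noteq> 0" and c: "\<forall>m. (\<Sum>j\<in>insert s S. c j * v j a m) = 0" for a c
      proof -
        have c': "(\<Sum>j\<in>S. c j * v j a m) = - (c s * v s a m)" for m
        proof -
          have "c s * v s a m + (\<Sum>j\<in>S. c j * v j a m) = 0"
            using c[rule_format, of m] insert.hyps by simp
          then show ?thesis by (metis add.commute add_eq_0_iff2)
        qed
        have "(\<Sum>j\<in>S. c j * w j a m) = 0" for m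
        proof -
          have "(\<Sum>j\<in>S. c j * w j a m)
              = ?p a * (\<Sum>j\<in>S. c j * v j a m) - (\<Sum>j\<in>S. c j * v j a m0) * v s a m"
            by (simp add: w_def sum_distrib_left sum_distrib_right sum_subtractf right_diff_distrib mult_ac)
          then show ?thesis by (simp add: c' mult_ac)
        qed
        then have z: "c j = 0" if "j \<in> S" for j using ind a that by auto
        then have "c s * v s a m0 = 0" using c'[of m0] by simp
        then show ?thesis using a z by auto
      qed
      ultimately show ?thesis
        by (intro disjI1 bexI[of _ "\<lambda>a. p a * ?p a"]) (auto intro!: exI[of _ a3])
    next
      assume "\<exists>c. (\<forall>j\<in>S. c j \<in> polyfuns) \<and> (\<exists>j\<in>S. \<exists>a. c j a \<noteq> 0) \<and>
            (\<forall>a m. (\<Sum>j\<in>S. c j a * w j a m) = 0)"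
      then obtain c j0 a2 where c: "\<And>j. j \<in> S \<Longrightarrow> c j \<in> polyfuns" "j0 \<in> S" "c j0 a2 \<noteq> 0"
        and rel: "\<forall>a m. (\<Sum>j\<in>S. c j a * w j a m) = 0" by blast
      obtain a3 where a3: "c j0 a3 \<noteq> 0" "?p a3 \<noteq> 0"
        using polyfuns_common_nonzero[OF inf c(1)[OF c(2)] P[of s m0] c(3) a1] by auto
      define c' where "c' = (\<lambda>j a. if j = s then - (\<Sum>j\<in>S. c j a * v j a m0) else c j a * ?p a)"
      have "c' j \<in> polyfuns" if "j \<in> insert s S" for j
        using that P c(1) unfolding c'_def
        by (cases "j = s") (auto intro!: polyfuns_uminus polyfuns_sum polyfuns_mult)
      moreover have "j0 \<noteq> s" using c(2) insert.hyps by auto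
      then have "c' j0 a3 \<noteq> 0" using a3 by (simp add: c'_def)
      moreover have "(\<Sum>j\<in>insert s S. c' j a * v j a m) = 0" for a m
      proof -
        have "(\<Sum>j\<in>S. c' j a * v j a m) = (\<Sum>j\<in>S. c j a * ?p a * v j a m)"
          using insert.hyps by (intro sum.cong) (auto simp: c'_def)
        then have "(\<Sum>j\<in>insert s S. c' j a * v j a m)
            = (\<Sum>j\<in>S. c j a * ?p a * v j a m) - (\<Sum>j\<in>S. c j a * v j a m0) * v s a m"
          using insert.hyps by (simp add: c'_def)
        also have "\<dots> = (\<Sum>j\<in>S. c j a * w j a m)"
          by (simp add: w_def sum_distrib_left sum_distrib_right sum_subtractf right_diff_distrib mult_ac)
        finally show ?thesis using rel by simp
      qed
      ultimately show ?thesis using c(2) by (intro disjI2 exI[of _ c']) auto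
    qed
  qed
qed

section \<open>McCoy's theorem\<close>

text \<open>McCoy's theorem modulo an ideal: a polynomial that is a zero divisor is annihilated by a constant.
  A nonzero annihilator \<open>g\<close> of least degree will do: if some coefficient of \<open>f\<close> does not annihilate \<open>g\<close>, the
  last such coefficient kills the leading coefficient of \<open>g\<close>, and multiplying \<open>g\<close> by it gives an
  annihilator of smaller degree.  Zero, annihilating and killing are meant modulo the ideal.\<close>

lemma McCoy:
  fixes f g :: "'r::comm_ring_1 poly"
  assumes J: "is_ideal J" and fg: "\<And>k. coeff (f * g) k \<in> J" and g: "coeff g i0 \<notin> J"
  obtains c where "c \<notin> J" "\<And>k. c * coeff f k \<in> J"
proof -
  have "\<exists>c. c \<notin> J \<and> (\<forall>k. c * coeff f k \<in> J)"
    \<comment> \<open>Vanishing from \<open>N\<close> on replaces the degree, so that zero needs no separate treatment.\<close>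
    if "\<And>i. i \<ge> N \<Longrightarrow> coeff g i = 0" for N
    using that fg g
  proof (induction N arbitrary: g i0)
    case 0
    then show ?case using ideal.subspace_0[OF J] by auto
  next
    case (Suc N)
    show ?case
    proof (cases "\<forall>k i. coeff f k * coeff g i \<in> J")
      case True
      then show ?thesis using Suc.prems(3) by (metis mult.commute)
    next
      case False
      define S where "S = {k. \<exists>i. coeff f k * coeff g i \<notin> J}"
      have "S \<subseteq> {..degree f}"
      proof
        fix k assume "k \<in> S"
        then have "coeff f k \<noteq> 0" using ideal.subspace_0[OF J] by (auto simp: S_def)
        then show "k \<in> {..degree f}" using le_degree by auto
      qed
      then have fin: "finite S" by (rule finite_subset) simp
      have "S \<noteq> {}" using False by (auto simp: S_def)
      define k where "k = Max S"
      have "k \<in> S" unfolding k_def using fin \<open>S \<noteq> {}\<close> by (rule Max_in)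
      then obtain i where i: "coeff f k * coeff g i \<notin> J" by (auto simp: S_def)
      have above: "coeff f l * coeff g j \<in> J" if "l > k" for l j
        using that Max_ge[OF fin, of l] by (force simp: S_def k_def)
      have top: "coeff f k * coeff g N \<in> J"
      proof -
        have "coeff f l * coeff g (k + N - l) \<in> J" if "l \<in> {..k + N} - {k}" for l
        proof (cases "l > k")
          case True
          then show ?thesis by (rule above)
        next
          case False
          then have "coeff g (k + N - l) = 0" using that by (intro Suc.prems(1)) auto
          then show ?thesis using ideal.subspace_0[OF J] by simp
        qed
        then have "(\<Sum>l\<in>{..k + N} - {k}. coeff f l * coeff g (k + N - l)) \<in> J"
          by (rule ideal.subspace_sum[OF J])
        moreover have "coeff (f * g) (k + N) = coeff f k * coeff g N
            + (\<Sum>l\<in>{..k + N} - {k}. coeff f l * coeff g (k + N - l))"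
          unfolding coeff_mult by (subst sum.remove[of _ k]) auto
        ultimately show ?thesis using Suc.prems(2)[of "k + N"] ideal.subspace_diff[OF J] by force
      qed
      let ?h = "smult (coeff f k) g - monom (coeff f k * coeff g N) N"
      have 1: "coeff ?h j = 0" if "j \<ge> N" for j
        using that Suc.prems(1)[of j] by (cases "j = N") auto
      have 2: "coeff (f * ?h) j \<in> J" for j
      proof -
        have "f * ?h = smult (coeff f k) (f * g) - monom (coeff f k * coeff g N) N * f"
          by (simp only: right_diff_distrib mult_smult_right mult.commute[of f "monom _ _"])
        then have "coeff (f * ?h) j = coeff f k * coeff (f * g) j
            - (if j < N then 0 else coeff f (j - N) * (coeff f k * coeff g N))"
          by (simp add: coeff_monom_mult mult.commute[of "coeff f (j - N)"])
        also have "\<dots> \<in> J"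
          using Suc.prems(2) top
          by (intro ideal.subspace_diff[OF J]) (auto intro: ideal.subspace_scale[OF J] ideal.subspace_0[OF J])
        finally show ?thesis .
      qed
      have "i \<noteq> N" using i top by auto
      then have 3: "coeff ?h i \<notin> J" using i by simp
      from Suc.IH[OF 1 2 3] show ?thesis .
    qed
  qed
  from this[of "Suc (degree g)"] that show ?thesis by (auto simp: coeff_eq_0)
qed

section \<open>Generic linear forms\<close>

text \<open>It is enough to consider basic open sets, the complements of a single hypersurface; over an infinite
  field they are stable under finite intersection.\<close>

definition generic :: "(('n::finite \<Rightarrow> 'k::field) \<Rightarrow> bool) \<Rightarrow> bool" where
  "generic Q \<longleftrightarrow> (\<exists>p\<in>polyfuns. (\<exists>a. p a \<noteq> 0) \<and> (\<forall>a. p a \<noteq> 0 \<longrightarrow> Q a))"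

lemma generic_conj:
  fixes P Q :: "('n::finite \<Rightarrow> 'k::field) \<Rightarrow> bool"
  assumes inf: "infinite (UNIV :: 'k set)" and "generic P" "generic Q"
  shows "generic (\<lambda>a. P a \<and> Q a)"
proof -
  obtain p a where p: "p \<in> polyfuns" "p a \<noteq> 0" "\<And>a. p a \<noteq> 0 \<Longrightarrow> P a"
    using assms(2) unfolding generic_def by blast
  obtain q b where q: "q \<in> polyfuns" "q b \<noteq> 0" "\<And>a. q a \<noteq> 0 \<Longrightarrow> Q a"
    using assms(3) unfolding generic_def by blast
  obtain c where "p c \<noteq> 0" "q c \<noteq> 0"
    using polyfuns_common_nonzero[OF inf p(1) q(1) p(2) q(2)] .
  then show ?thesis
    unfolding generic_def using p(3) q(3)
    by (intro bexI[OF _ polyfuns_mult[OF p(1) q(1)]] conjI exI[of _ c]) auto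
qed

lemma generic_mono: "generic P \<Longrightarrow> (\<And>a. P a \<Longrightarrow> Q a) \<Longrightarrow> generic Q"
  unfolding generic_def by blast

lemma generic_True: "generic (\<lambda>_. True)"
  unfolding generic_def by (rule bexI[OF _ polyfuns_const[of 1]]) simp

lemma weak_lefschetz_if_generic:
  assumes "generic (\<lambda>a. \<forall>i. maximal_rank_at I (linear_form a) i)"
  shows "weak_lefschetz I"
proof -
  obtain q where "\<exists>a. eval q a \<noteq> 0"
    "\<And>a. eval q a \<noteq> 0 \<Longrightarrow> \<forall>i. maximal_rank_at I (linear_form a) i"
    using assms unfolding generic_def polyfuns_def by blast
  moreover have "zariski_open {a. eval q a \<noteq> 0}"
    unfolding zariski_open_def by (rule exI[of _ "{q}"]) simp
  ultimately show ?thesis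
    unfolding weak_lefschetz_def by (intro exI[of _ "{a. eval q a \<noteq> 0}"]) auto
qed

abbreviation var :: "'n::finite \<Rightarrow> ('n, 'k::field) mpol" where
  "var v \<equiv> monomial (Poly_Mapping.single v 1)"

lemma linear_form_eq: "linear_form a = (\<Sum>v\<in>UNIV. smul (a v) (var v))"
  by (simp add: linear_form_def smul_single)

text \<open>Each coordinate modulo \<open>J\<close> of the values of \<open>h\<close> is a univariate polynomial with infinitely many roots, so all
  its coefficients vanish.\<close>

lemma coeffs_in_subspace:
  fixes h :: "('n::finite, 'k::field) mpol poly"
  assumes inf: "infinite (UNIV :: 'k set)" and J: "mpol.subspace J"
    and h: "\<And>t. poly h (Poly_Mapping.single 0 t) \<in> J"
  shows "coeff h i \<in> J"
proof -
  obtain \<pi> where \<pi>: "Vector_Spaces.linear smul smul \<pi>"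
    "\<And>x. x - \<pi> x \<in> J" "\<And>x. \<pi> x = 0 \<longleftrightarrow> x \<in> J"
    by (rule mpol.projection_with_kernel[OF J]) blast
  interpret \<pi>: Vector_Spaces.linear smul smul \<pi> by (fact \<pi>(1))
  have "Poly_Mapping.lookup (\<pi> (coeff h i)) m = 0" for m
  proof -
    define r where "r = (\<Sum>j\<le>degree h. monom (Poly_Mapping.lookup (\<pi> (coeff h j)) m) j)"
    have "poly r t = 0" for t
    proof -
      have K: "Poly_Mapping.single 0 t ^ j = Poly_Mapping.single 0 (t ^ j)" for j
        by (induction j) (simp_all add: mult_single)
      have "poly h (Poly_Mapping.single 0 t) = (\<Sum>j\<le>degree h. smul (t ^ j) (coeff h j))"
        by (simp add: poly_altdef K smul_def mult.commute[of "coeff h _"])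
      then have "\<pi> (\<Sum>j\<le>degree h. smul (t ^ j) (coeff h j)) = 0"
        unfolding \<pi>(3) using h[of t] by simp
      then have "Poly_Mapping.lookup (\<pi> (\<Sum>j\<le>degree h. smul (t ^ j) (coeff h j))) m = 0"
        by (simp only: lookup_zero)
      then show ?thesis
        by (simp add: \<pi>.sum \<pi>.scale lookup_sum r_def poly_sum poly_monom mult.commute)
    qed
    then have "r = 0" using poly_nonroot[OF inf] by blast
    then have "coeff r i = 0" by simp
    then show ?thesis
      by (cases "i \<le> degree h") (simp_all add: r_def coeff_sum coeff_eq_0 \<pi>.zero)
  qed
  then have "\<pi> (coeff h i) = 0" by (intro poly_mapping_eqI) simp
  then show ?thesis using \<pi>(3) by simp
qed

lemma poly_map_poly_const:
  "poly (map_poly (Poly_Mapping.single 0) q) (Poly_Mapping.single 0 t) = Poly_Mapping.single 0 (poly q t)"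
  by (induction q) (simp_all add: map_poly_pCons single_add mult_single)

text \<open>Restrict a syzygy of the general linear form that is nontrivial at \<open>a\<close> to the curve
  \<open>t \<mapsto> (a v + t\<^bsup>Suc (\<iota> v)\<^esup>)\<close>.  It becomes an equation between polynomials in \<open>t\<close> over the polynomial ring,
  in which every variable \<open>v\<close> is a coefficient of the linear form.  By McCoy's theorem some \<open>c\<close> outside \<open>J\<close>
  is then multiplied into \<open>J\<close> by all variables.\<close>

lemma no_generic_syzygy:
  fixes J :: "('n::finite, 'k::field) mpol set"
  assumes inf: "infinite (UNIV :: 'k set)" and J: "is_ideal J"
    and sat: "\<And>c. (\<And>v. var v * c \<in> J) \<Longrightarrow> c \<in> J"
    and \<gamma>: "finite C" "\<And>c. c \<in> C \<Longrightarrow> \<gamma> c \<in> polyfuns"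
    and syz: "\<And>a. linear_form a * (\<Sum>c\<in>C. smul (\<gamma> c a) c) \<in> J"
  shows "(\<Sum>c\<in>C. smul (\<gamma> c a) c) \<in> J"
proof (rule ccontr)
  assume notin: "(\<Sum>c\<in>C. smul (\<gamma> c a) c) \<notin> J"
  obtain \<iota> :: "'n \<Rightarrow> nat" where \<iota>: "inj \<iota>"
    using finite_imp_inj_to_nat_seg[of "UNIV :: 'n set"] by auto
  \<comment> \<open>Positive exponents make the curve pass through \<open>a\<close> at \<open>t = 0\<close>; distinct ones separate the variables.\<close>
  define \<kappa> where "\<kappa> = (\<lambda>v. [:a v:] + monom 1 (Suc (\<iota> v)))"
  have "\<forall>c\<in>C. \<exists>q. \<forall>t. \<gamma> c (\<lambda>v. poly (\<kappa> v) t) = poly q t"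
    using polyfun_along_curve[OF \<gamma>(2), of _ \<kappa>] by metis
  then obtain q where q: "\<And>c t. c \<in> C \<Longrightarrow> \<gamma> c (\<lambda>v. poly (\<kappa> v) t) = poly (q c) t"
    by metis
  let ?K = "\<lambda>t. Poly_Mapping.single 0 t :: ('n, 'k) mpol"
  define f where "f = [:linear_form a:] + (\<Sum>v\<in>UNIV. monom (var v) (Suc (\<iota> v)))"
  define g where "g = (\<Sum>c\<in>C. map_poly ?K (q c) * [:c:])"
  have K: "?K t ^ j = ?K (t ^ j)" for t j
    by (induction j) (simp_all add: mult_single)
  have f: "poly f (?K t) = linear_form (\<lambda>v. poly (\<kappa> v) t)" for t
    by (simp add: f_def poly_sum poly_monom K linear_form_def \<kappa>_def single_add sum.distrib mult_single)
  have g: "poly g (?K t) = (\<Sum>c\<in>C. smul (\<gamma> c (\<lambda>v. poly (\<kappa> v) t)) c)" for t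
    by (simp add: g_def poly_sum poly_map_poly_const smul_def q mult.commute)
  have "poly (f * g) (?K t) \<in> J" for t
    using syz[of "\<lambda>v. poly (\<kappa> v) t"] by (simp add: f g)
  then have fg: "coeff (f * g) k \<in> J" for k
    by (rule coeffs_in_subspace[OF inf ideal_imp_subspace[OF J]])
  have "coeff g 0 = poly g (?K 0)" by (simp add: poly_0_coeff_0)
  also have "\<dots> = (\<Sum>c\<in>C. smul (\<gamma> c a) c)" by (simp only: g) (simp add: \<kappa>_def poly_monom)
  finally have "coeff g 0 \<notin> J" using notin by simp
  from McCoy[OF J fg this] obtain c where c: "c \<notin> J" "\<And>k. c * coeff f k \<in> J" by blast
  have "coeff f (Suc (\<iota> v)) = var v" for v
  proof -
    have "coeff f (Suc (\<iota> v)) = (\<Sum>w\<in>UNIV. if w = v then var w else 0)"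
      using \<iota> by (auto simp: f_def coeff_sum inj_eq intro!: sum.cong)
    then show ?thesis by simp
  qed
  then have "var v * c \<in> J" for v using c(2)[of "Suc (\<iota> v)"] by (simp add: mult.commute)
  then show False using sat c(1) by blast
qed

text \<open>If no element outside \<open>J\<close> is multiplied into \<open>J\<close> by all variables, the general linear form is a
  nonzerodivisor modulo \<open>J\<close> on every finite-dimensional space: otherwise elimination produces a syzygy with
  coefficients polynomial in \<open>a\<close>.\<close>

lemma generic_linear_form_injective:
  fixes J :: "('n::finite, 'k::field) mpol set"
  assumes inf: "infinite (UNIV :: 'k set)" and J: "is_ideal J"
    and sat: "\<And>c. (\<And>v. var v * c \<in> J) \<Longrightarrow> c \<in> J" and X: "finite X"
  shows "generic (\<lambda>a. \<forall>g\<in>mpol.span X. linear_form a * g \<in> J \<longrightarrow> g \<in> J)"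
proof -
  note J' = ideal_imp_subspace[OF J]
  obtain \<pi> where \<pi>: "Vector_Spaces.linear smul smul \<pi>"
    "\<And>x. x - \<pi> x \<in> J" "\<And>x. \<pi> x = 0 \<longleftrightarrow> x \<in> J"
    by (rule mpol.projection_with_kernel[OF J']) blast
  interpret \<pi>: Vector_Spaces.linear smul smul \<pi> by (fact \<pi>(1))
  have idem: "\<pi> (\<pi> x) = \<pi> x" for x
    using \<pi>(2,3)[of "x"] \<pi>(3)[of "x - \<pi> x"] by (simp add: \<pi>.diff)
  \<comment> \<open>A basis of the space modulo \<open>J\<close>, made of vectors that \<open>\<pi>\<close> fixes.\<close>
  obtain C where C: "C \<subseteq> \<pi> ` mpol.span X" "\<not> mpol.dependent C" "\<pi> ` mpol.span X \<subseteq> mpol.span C"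
    "card C = mpol.dim (\<pi> ` mpol.span X)"
    by (rule mpol.basis_exists)
  have "C \<subseteq> mpol.span (\<pi> ` X)" using C(1) \<pi>.span_image by simp
  then have finC: "finite C" using mpol.independent_span_bound[OF _ C(2)] X by blast
  have fixC: "\<pi> c = c" if "c \<in> C" for c using C(1) that idem by auto
  have fix_span: "\<pi> (\<Sum>c\<in>C. smul (u c) c) = (\<Sum>c\<in>C. smul (u c) c)" for u
    by (simp add: \<pi>.sum \<pi>.scale fixC)
  have indep: "u c = 0" if "(\<Sum>c\<in>C. smul (u c) c) \<in> J" "c \<in> C" for u c
    using mpol.independentD[OF C(2) finC subset_refl, of u c] \<pi>(3) fix_span that by metis
  define v where "v = (\<lambda>c a m. Poly_Mapping.lookup (\<pi> (linear_form a * c)) m)"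
  have v_eq: "v c a m = (\<Sum>i\<in>UNIV. a i * Poly_Mapping.lookup (\<pi> (var i * c)) m)" for c a m
    by (simp add: v_def linear_form_eq sum_distrib_right mult_smul \<pi>.sum \<pi>.scale lookup_sum)
  have v_sum: "(\<Sum>c\<in>C. u c * v c a m) = Poly_Mapping.lookup (\<pi> (linear_form a * (\<Sum>c\<in>C. smul (u c) c))) m" for u a m
    by (simp add: v_def sum_distrib_left mult_smul \<pi>.sum \<pi>.scale lookup_sum)
  have "(\<lambda>a. v c a m) \<in> polyfuns" for c m
    unfolding v_eq by (intro polyfuns_sum polyfuns_mult polyfuns_coordinate polyfuns_const)
  from generic_independence_or_relation[OF inf finC this] show ?thesis
  proof
    assume "\<exists>p\<in>polyfuns. (\<exists>a. p a \<noteq> 0) \<and>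
            (\<forall>a. p a \<noteq> 0 \<longrightarrow> (\<forall>c. (\<forall>m. (\<Sum>j\<in>C. c j * v j a m) = 0) \<longrightarrow> (\<forall>j\<in>C. c j = 0)))"
    then have "generic (\<lambda>a. \<forall>c. (\<forall>m. (\<Sum>j\<in>C. c j * v j a m) = 0) \<longrightarrow> (\<forall>j\<in>C. c j = 0))"
      unfolding generic_def .
    then show ?thesis
    proof (rule generic_mono, intro ballI impI)
      fix a g
      assume ind: "\<forall>c. (\<forall>m. (\<Sum>j\<in>C. c j * v j a m) = 0) \<longrightarrow> (\<forall>j\<in>C. c j = 0)"
        and g: "g \<in> mpol.span X" "linear_form a * g \<in> J"
      have "\<pi> g \<in> mpol.span C" using C(3) g(1) by auto
      then obtain u where u: "\<pi> g = (\<Sum>c\<in>C. smul (u c) c)"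
        unfolding mpol.span_finite[OF finC] by auto
      have "linear_form a * g - linear_form a * (g - \<pi> g) \<in> J"
        using g(2) ideal.subspace_scale[OF J \<pi>(2)] by (rule ideal.subspace_diff[OF J])
      then have "linear_form a * \<pi> g \<in> J" by (simp add: right_diff_distrib)
      then have "\<pi> (linear_form a * (\<Sum>c\<in>C. smul (u c) c)) = 0" using \<pi>(3) u by simp
      then have "(\<Sum>c\<in>C. u c * v c a m) = 0" for m by (simp add: v_sum)
      then have "\<forall>c\<in>C. u c = 0" using ind by blast
      then have "\<pi> g = 0" using u by simp
      then show "g \<in> J" using \<pi>(3) by simp
    qed
  next
    assume "\<exists>c. (\<forall>j\<in>C. c j \<in> polyfuns) \<and> (\<exists>j\<in>C. \<exists>a. c j a \<noteq> 0) \<and>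
            (\<forall>a m. (\<Sum>j\<in>C. c j a * v j a m) = 0)"
    then obtain \<gamma> c0 a0 where \<gamma>: "\<And>c. c \<in> C \<Longrightarrow> \<gamma> c \<in> polyfuns" "c0 \<in> C" "\<gamma> c0 a0 \<noteq> 0"
      and rel: "\<forall>a m. (\<Sum>j\<in>C. \<gamma> j a * v j a m) = 0" by blast
    have "linear_form a * (\<Sum>c\<in>C. smul (\<gamma> c a) c) \<in> J" for a
    proof -
      have "\<pi> (linear_form a * (\<Sum>c\<in>C. smul (\<gamma> c a) c)) = 0"
        using rel by (intro poly_mapping_eqI) (simp add: v_sum)
      then show ?thesis using \<pi>(3) by simp
    qed
    from no_generic_syzygy[OF inf J sat finC \<gamma>(1) this, of a0]
    have "\<gamma> c0 a0 = 0" using indep[of "\<lambda>c. \<gamma> c a0" c0] \<gamma>(2) by blast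
    then show ?thesis using \<gamma>(3) by contradiction
  qed
qed

lemma monomial_factor:
  assumes "monom_deg m = Suc i"
  obtains v m' where "Poly_Mapping.single m (c :: 'k::field) = var v * Poly_Mapping.single m' c" "monom_deg m' = i"
proof -
  have "monom_deg m \<noteq> 0" using assms by simp
  then obtain v where v: "Poly_Mapping.lookup m v \<noteq> 0" unfolding monom_deg_def by (meson sum.neutral)
  let ?m = "m - Poly_Mapping.single v 1"
  have m: "m = Poly_Mapping.single v 1 + ?m"
    using v by (intro poly_mapping_eqI) (auto simp: lookup_add lookup_minus lookup_single when_def)
  have "monom_deg ?m = i" using assms monom_deg_add[of "Poly_Mapping.single v 1" ?m] m by simp
  moreover have "Poly_Mapping.single m c = var v * Poly_Mapping.single ?m c"
    using m by (simp add: mult_single)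
  ultimately show ?thesis using that by blast
qed

lemma form_mult_in_ideal:
  fixes J :: "('n::finite, 'k::field) mpol set"
  assumes J: "is_ideal J" and c: "\<And>v. var v * c \<in> J" and f: "f \<in> forms (Suc i)"
  shows "f * c \<in> J"
proof -
  have "Poly_Mapping.single m (Poly_Mapping.lookup f m) * c \<in> J" if "m \<in> Poly_Mapping.keys f" for m
  proof -
    have "monom_deg m = Suc i" using f that by (auto simp: forms_def)
    from monomial_factor[OF this, of "Poly_Mapping.lookup f m"] obtain v m' where
      "Poly_Mapping.single m (Poly_Mapping.lookup f m) = var v * Poly_Mapping.single m' (Poly_Mapping.lookup f m)" by blast
    then have "Poly_Mapping.single m (Poly_Mapping.lookup f m) * c = Poly_Mapping.single m' (Poly_Mapping.lookup f m) * (var v * c)"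
      by (simp only: mult_ac)
    then show ?thesis using ideal.subspace_scale[OF J c] by metis
  qed
  then have "(\<Sum>m\<in>Poly_Mapping.keys f. Poly_Mapping.single m (Poly_Mapping.lookup f m) * c) \<in> J"
    by (rule ideal.subspace_sum[OF J])
  then show ?thesis using mpol_eq_sum_single[of f] by (simp flip: sum_distrib_right)
qed

text \<open>A form of positive degree is a combination of variables times forms of one degree less, so a preimage
  modulo \<open>J\<close> can be shifted up degree by degree.  Hence surjectivity in all degrees from \<open>e\<close> on costs only one
  condition on the linear form.\<close>

lemma surjective_propagates:
  fixes J :: "('n::finite, 'k::field) mpol set"
  assumes J: "is_ideal J"
    and surj: "\<And>f. f \<in> forms (Suc e) \<Longrightarrow> \<exists>g\<in>forms e. f - L * g \<in> J"
    and "e \<le> i" "f \<in> forms (Suc i)"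
  shows "\<exists>g\<in>forms i. f - L * g \<in> J"
  using assms(3,4)
proof (induction i arbitrary: f rule: dec_induct)
  case base
  then show ?case by (rule surj)
next
  case (step i)
  have "\<exists>g\<in>forms (Suc i). Poly_Mapping.single m (Poly_Mapping.lookup f m) - L * g \<in> J" if m: "m \<in> Poly_Mapping.keys f" for m
  proof -
    have "monom_deg m = Suc (Suc i)" using m step.prems by (auto simp: forms_def)
    then obtain v m' where vm: "Poly_Mapping.single m (Poly_Mapping.lookup f m) = var v * Poly_Mapping.single m' (Poly_Mapping.lookup f m)"
      "monom_deg m' = Suc i" by (rule monomial_factor)
    obtain g where g: "g \<in> forms i" "Poly_Mapping.single m' (Poly_Mapping.lookup f m) - L * g \<in> J"
      using step.IH[OF single_in_forms[OF vm(2)]] by blast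
    have "Poly_Mapping.single m (Poly_Mapping.lookup f m) - L * (var v * g)
        = var v * (Poly_Mapping.single m' (Poly_Mapping.lookup f m) - L * g)"
      by (simp add: vm(1) right_diff_distrib mult.left_commute)
    also have "\<dots> \<in> J" using g(2) by (rule ideal.subspace_scale[OF J])
    finally have "Poly_Mapping.single m (Poly_Mapping.lookup f m) - L * (var v * g) \<in> J" .
    moreover have "var v * g \<in> forms (Suc i)"
      using mult_in_forms[OF single_in_forms g(1), of "Poly_Mapping.single v 1" 1 1] by simp
    ultimately show ?thesis by blast
  qed
  then obtain g where g: "\<And>m. m \<in> Poly_Mapping.keys f \<Longrightarrow> g m \<in> forms (Suc i)"
    "\<And>m. m \<in> Poly_Mapping.keys f \<Longrightarrow> Poly_Mapping.single m (Poly_Mapping.lookup f m) - L * g m \<in> J" by metis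
  have "(\<Sum>m\<in>Poly_Mapping.keys f. Poly_Mapping.single m (Poly_Mapping.lookup f m) - L * g m) \<in> J"
    using g(2) by (rule ideal.subspace_sum[OF J])
  then have "f - L * (\<Sum>m\<in>Poly_Mapping.keys f. g m) \<in> J"
    using mpol_eq_sum_single[of f] by (simp add: sum_subtractf sum_distrib_left)
  moreover have "(\<Sum>m\<in>Poly_Mapping.keys f. g m) \<in> forms (Suc i)"
    using g(1) by (rule mpol.subspace_sum[OF subspace_forms])
  ultimately show ?case by blast
qed

text \<open>An injective map between spaces of equal finite dimension is onto; the dimensions of the two graded
  pieces agree by the assumption on the Hilbert series.\<close>

lemma surjective_if_hilbert_stable:
  fixes J :: "('n::finite, 'k::field) mpol set"
  assumes J: "is_ideal J" and L: "L \<in> forms 1"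
    and inj: "\<And>g. g \<in> forms e \<Longrightarrow> L * g \<in> J \<Longrightarrow> g \<in> J"
    and stable: "fps_nth (hilbert J) (Suc e) = fps_nth (hilbert J) e"
    and f: "f \<in> forms (Suc e)"
  shows "\<exists>g\<in>forms e. f - L * g \<in> J"
proof -
  let ?T = "{u + L * v | u v. u \<in> J \<inter> forms (Suc e) \<and> v \<in> forms e}"
  have "mpol.dim ?T + mpol.dim (J \<inter> forms e)
      = mpol.dim (J \<inter> forms (Suc e)) + mpol.dim (forms e :: ('n, 'k) mpol set)"
    using dim_mult_mod_ideal[OF J L inj] by simp
  then have dim: "mpol.dim (forms (Suc e) :: ('n, 'k) mpol set) \<le> mpol.dim ?T"
    using stable by (simp add: hilbert_def)
  have L_image: "mpol.subspace ((*) L ` forms e)"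
  proof -
    interpret L: Vector_Spaces.linear smul smul "(*) L" by (rule linear_mult)
    show ?thesis by (rule L.subspace_image[OF subspace_forms])
  qed
  have "?T = {x + y | x y. x \<in> J \<inter> forms (Suc e) \<and> y \<in> (*) L ` forms e}" by blast
  then have "mpol.subspace ?T"
    using mpol.subspace_sums[OF mpol.subspace_inter[OF ideal_imp_subspace[OF J] subspace_forms] L_image]
    by simp
  moreover have "?T \<subseteq> forms (Suc e)"
    using mult_in_forms[OF L] by (auto intro: mpol.subspace_add[OF subspace_forms])
  ultimately have "?T = forms (Suc e)"
    using finite_imageI[OF finite_monomials] forms_subset_span dim
    by (rule mpol.subset_dim_eq_imp_eq)
  then obtain u v where "f = u + L * v" "u \<in> J" "v \<in> forms e" using f by blast
  then show ?thesis by (auto intro: bexI[of _ v])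
qed

section \<open>Regular sequences and the general linear form\<close>

text \<open>A form \<open>G\<close> of positive degree that is regular modulo \<open>J\<close> keeps the irrelevant ideal from being associated
  to \<open>J\<close>, so the general linear form is injective in any finite range of degrees.  The graded
  pieces of degrees \<open>e\<close> and \<open>e + 1\<close> have equal dimension, so injectivity turns into surjectivity there,
  and then beyond.\<close>

lemma generic_section_of_regular_sequence:
  fixes F :: "nat \<Rightarrow> ('n::finite, 'k::field) mpol" and r :: nat
  defines "J \<equiv> ideal_gen (F ` {1..r})"
  assumes inf: "infinite (UNIV :: 'k set)" and r: "Suc r = card (UNIV :: 'n set)"
    and F: "\<And>j. j \<in> {1..r} \<Longrightarrow> F j \<in> forms (d j)"
    and nzd: "\<And>j g. j \<in> {1..r} \<Longrightarrow> F j * g \<in> ideal_gen (F ` {1..<j}) \<Longrightarrow> g \<in> ideal_gen (F ` {1..<j})"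
    and G: "G \<in> forms (Suc k)" "\<And>g. G * g \<in> J \<Longrightarrow> g \<in> J"
    and e: "e = (\<Sum>j=1..r. d j - 1)"
  shows "generic (\<lambda>a. (\<forall>i\<le>e. \<forall>g\<in>forms i. linear_form a * g \<in> J \<longrightarrow> g \<in> J) \<and>
    (\<forall>i\<ge>e. \<forall>f\<in>forms (Suc i). \<exists>g\<in>forms i. f - linear_form a * g \<in> J))"
proof -
  have J: "is_ideal J" unfolding J_def by (rule ideal.subspace_span)
  have sat: "c \<in> J" if "\<And>v. var v * c \<in> J" for c
    using form_mult_in_ideal[OF J that G(1)] G(2) by blast
  let ?X = "\<Union>i\<in>{..e}. monomial ` {m. monom_deg m = i} :: ('n, 'k) mpol set"
  have span: "forms i \<subseteq> mpol.span ?X" if "i \<le> e" for i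
    using forms_subset_span[of i] mpol.span_mono[of "monomial ` {m. monom_deg m = i}" ?X] that by blast
  have "finite ?X" by (intro finite_UN_I finite_imageI finite_monomials finite_atMost)
  from generic_linear_form_injective[OF inf J sat this] show ?thesis
  proof (rule generic_mono)
    fix a assume a: "\<forall>g\<in>mpol.span ?X. linear_form a * g \<in> J \<longrightarrow> g \<in> J"
    have inj: "\<forall>i\<le>e. \<forall>g\<in>forms i. linear_form a * g \<in> J \<longrightarrow> g \<in> J"
      using a span by blast
    have stable: "fps_nth (hilbert J) (Suc e) = fps_nth (hilbert J) e"
      unfolding J_def by (rule hilbert_stable[OF F nzd r e])
    have base: "\<exists>g\<in>forms e. f - linear_form a * g \<in> J" if f: "f \<in> forms (Suc e)" for f
      by (rule surjective_if_hilbert_stable[OF J linear_form_in_forms _ stable f]) (use inj in blast)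
    have "\<forall>i\<ge>e. \<forall>f\<in>forms (Suc i). \<exists>g\<in>forms i. f - linear_form a * g \<in> J"
      using surjective_propagates[OF J base] by blast
    with inj show "(\<forall>i\<le>e. \<forall>g\<in>forms i. linear_form a * g \<in> J \<longrightarrow> g \<in> J) \<and>
      (\<forall>i\<ge>e. \<forall>f\<in>forms (Suc i). \<exists>g\<in>forms i. f - linear_form a * g \<in> J)" by blast
  qed
qed

text \<open>In two variables the linear form \<open>a\<close> vanishes at the point \<open>(- a y, a x)\<close>, so it can only divide \<open>F\<close> if
  \<open>F\<close> vanishes there as well.  The value of \<open>F\<close> at this point is a nonzero polynomial function of \<open>a\<close>.\<close>

lemma generic_not_divisor:
  fixes F :: "('n::finite, 'k::field) mpol"
  assumes inf: "infinite (UNIV :: 'k set)" and two: "card (UNIV :: 'n set) = 2"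
    and F: "F \<in> forms D" "F \<noteq> 0"
  shows "generic (\<lambda>a. \<forall>g c. linear_form a * g = smul c F \<longrightarrow> c = 0)"
proof -
  obtain x y :: 'n where xy: "UNIV = {x, y}" "x \<noteq> y" using two by (auto simp: card_2_iff)
  have sum_xy: "sum h UNIV = h x + h y" for h :: "'n \<Rightarrow> 'b::comm_monoid_add"
    unfolding xy(1) using xy(2) by simp
  have prod_xy: "prod h UNIV = h x * h y" for h :: "'n \<Rightarrow> 'k"
    unfolding xy(1) using xy(2) by simp
  define \<sigma> where "\<sigma> = (\<lambda>v (a :: 'n \<Rightarrow> 'k). if v = x then - a y else a x)"
  let ?p = "\<lambda>a. eval F (\<lambda>v. \<sigma> v a)"
  have "\<sigma> v \<in> polyfuns" for v
    unfolding \<sigma>_def by (cases "v = x") (simp_all add: polyfuns_uminus polyfuns_coordinate)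
  then have p: "?p \<in> polyfuns" by (rule polyfuns_eval_compose)
  have "\<exists>a. ?p a \<noteq> 0"
  proof -
    \<comment> \<open>The dehomogenisation of \<open>F\<close>, whose values are those of \<open>F\<close> at \<open>(t, 1)\<close>.\<close>
    define q where "q = (\<Sum>m\<in>Poly_Mapping.keys F. monom (Poly_Mapping.lookup F m) (Poly_Mapping.lookup m x))"
    obtain m0 where m0: "m0 \<in> Poly_Mapping.keys F" using F(2) by (metis keys_eq_empty ex_in_conv)
    have deg: "Poly_Mapping.lookup m x + Poly_Mapping.lookup m y = D" if "m \<in> Poly_Mapping.keys F" for m
      using F(1) that by (auto simp: forms_def monom_deg_def sum_xy)
    have eq: "m = m0" if "m \<in> Poly_Mapping.keys F" "Poly_Mapping.lookup m x = Poly_Mapping.lookup m0 x" for m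
    proof (rule poly_mapping_eqI)
      fix v
      have "v = x \<or> v = y" using xy(1) by auto
      then show "Poly_Mapping.lookup m v = Poly_Mapping.lookup m0 v" using deg[OF that(1)] deg[OF m0] that(2) by auto
    qed
    have "coeff q (Poly_Mapping.lookup m0 x) = (\<Sum>m\<in>Poly_Mapping.keys F. if m = m0 then Poly_Mapping.lookup F m else 0)"
      unfolding q_def coeff_sum by (rule sum.cong) (auto dest: eq)
    then have "coeff q (Poly_Mapping.lookup m0 x) \<noteq> 0" using m0 by (simp add: in_keys_iff)
    then have "q \<noteq> 0" by auto
    then obtain t where t: "poly q t \<noteq> 0" using poly_nonroot[OF inf] by blast
    have "?p (\<lambda>v. if v = x then 1 else - t) = poly q t"
      using xy(2) by (auto simp: eval_def q_def poly_sum poly_monom \<sigma>_def prod_xy intro!: sum.cong)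
    then show ?thesis using t by metis
  qed
  moreover have "c = 0" if a: "?p a \<noteq> 0" and g: "linear_form a * g = smul c F" for a g c
  proof -
    have "eval (linear_form a) (\<lambda>v. \<sigma> v a) = (\<Sum>v\<in>UNIV. a v * \<sigma> v a)"
    proof -
      have "(\<Prod>i\<in>UNIV. \<sigma> i a ^ Poly_Mapping.lookup (Poly_Mapping.single v 1) i) = \<sigma> v a" for v
      proof -
        have "(\<Prod>i\<in>UNIV. \<sigma> i a ^ Poly_Mapping.lookup (Poly_Mapping.single v 1) i) = (\<Prod>i\<in>UNIV. if i = v then \<sigma> i a else 1)"
          by (rule prod.cong) (auto simp: lookup_single when_def)
        then show ?thesis by simp
      qed
      then show ?thesis by (simp add: linear_form_def eval_sum eval_single)
    qed
    also have "\<dots> = 0" using xy(2) by (simp add: \<sigma>_def sum_xy mult.commute)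
    finally have "eval (smul c F) (\<lambda>v. \<sigma> v a) = 0" unfolding g[symmetric] by (simp add: eval_mult)
    then show ?thesis using a by (simp add: smul_def eval_mult eval_single)
  qed
  ultimately show ?thesis unfolding generic_def by (intro bexI[OF _ p]) blast
qed

section \<open>Maximal rank\<close>

lemma quot_mult_coset:
  assumes "is_ideal I"
  shows "quot_mult I L (cong_rel I `` {f}) = cong_rel I `` {L * f}"
proof (intro equalityI subsetI)
  fix k assume "k \<in> quot_mult I L (cong_rel I `` {f})"
  then obtain h where h: "f - h \<in> I" "L * h - k \<in> I" by (auto simp: quot_mult_def cong_rel_def)
  have "L * (f - h) + (L * h - k) \<in> I"
    using h by (intro ideal.subspace_add[OF assms] ideal.subspace_scale[OF assms])
  then show "k \<in> cong_rel I `` {L * f}" by (simp add: cong_rel_def right_diff_distrib)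
next
  fix k assume "k \<in> cong_rel I `` {L * f}"
  moreover have "f \<in> cong_rel I `` {f}" using ideal.subspace_0[OF assms] by (simp add: cong_rel_def)
  ultimately show "k \<in> quot_mult I L (cong_rel I `` {f})"
    by (auto simp: quot_mult_def cong_rel_def intro: exI[of _ f])
qed

lemma coset_eq_iff:
  assumes "is_ideal I"
  shows "cong_rel I `` {f} = cong_rel I `` {g} \<longleftrightarrow> f - g \<in> I"
proof
  assume "cong_rel I `` {f} = cong_rel I `` {g}"
  moreover have "g \<in> cong_rel I `` {g}" using ideal.subspace_0[OF assms] by (simp add: cong_rel_def)
  ultimately have "g \<in> cong_rel I `` {f}" by simp
  then show "f - g \<in> I" by (simp add: cong_rel_def)
next
  assume fg: "f - g \<in> I"
  have "f - k \<in> I \<longleftrightarrow> g - k \<in> I" for k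
  proof
    assume "f - k \<in> I"
    from ideal.subspace_diff[OF assms this fg] show "g - k \<in> I" by simp
  next
    assume "g - k \<in> I"
    from ideal.subspace_add[OF assms fg this] show "f - k \<in> I" by simp
  qed
  then show "cong_rel I `` {f} = cong_rel I `` {g}" by (simp add: cong_rel_def set_eq_iff)
qed

lemma maximal_rank_if_injective:
  assumes I: "is_ideal I" and inj: "\<And>g. g \<in> forms i \<Longrightarrow> L * g \<in> I \<Longrightarrow> g \<in> I"
  shows "maximal_rank_at I L i"
  unfolding maximal_rank_at_def
proof (rule disjI1, rule inj_onI)
  fix C D assume C: "C \<in> quot_piece I i" "D \<in> quot_piece I i" and eq: "quot_mult I L C = quot_mult I L D"
  obtain f where f: "f \<in> forms i" "C = cong_rel I `` {f}" using C(1) by (auto simp: quot_piece_def quotient_def)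
  obtain g where g: "g \<in> forms i" "D = cong_rel I `` {g}" using C(2) by (auto simp: quot_piece_def quotient_def)
  have "L * (f - g) \<in> I"
    using eq by (simp add: f g quot_mult_coset[OF I] coset_eq_iff[OF I] right_diff_distrib)
  then have "f - g \<in> I" using inj mpol.subspace_diff[OF subspace_forms f(1) g(1)] by blast
  then show "C = D" by (simp add: f g coset_eq_iff[OF I])
qed

lemma maximal_rank_if_surjective:
  assumes I: "is_ideal I" and L: "L \<in> forms 1"
    and surj: "\<And>f. f \<in> forms (Suc i) \<Longrightarrow> \<exists>g\<in>forms i. f - L * g \<in> I"
  shows "maximal_rank_at I L i"
  unfolding maximal_rank_at_def
proof (rule disjI2, intro equalityI subsetI)
  fix D assume "D \<in> quot_mult I L ` quot_piece I i"
  then obtain f where "f \<in> forms i" "D = cong_rel I `` {L * f}"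
    by (auto simp: quot_piece_def quotient_def quot_mult_coset[OF I])
  then show "D \<in> quot_piece I (Suc i)"
    using mult_in_forms[OF L, of f i] by (auto simp: quot_piece_def quotient_def)
next
  fix D assume "D \<in> quot_piece I (Suc i)"
  then obtain f where f: "f \<in> forms (Suc i)" "D = cong_rel I `` {f}"
    by (auto simp: quot_piece_def quotient_def)
  obtain g where g: "g \<in> forms i" "f - L * g \<in> I" using surj[OF f(1)] by blast
  have "D = quot_mult I L (cong_rel I `` {g})"
    using g(2) by (simp add: f quot_mult_coset[OF I] coset_eq_iff[OF I])
  moreover have "cong_rel I `` {g} \<in> quot_piece I i"
    using g(1) by (auto simp: quot_piece_def quotient_def)
  ultimately show "D \<in> quot_mult I L ` quot_piece I i" by blast
qed

section \<open>The Weak Lefschetz property\<close>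

lemma form_of_degree_zero:
  assumes "f \<in> forms 0"
  shows "f = Poly_Mapping.single 0 (Poly_Mapping.lookup f 0)"
proof -
  have "Poly_Mapping.lookup f m = 0" if "m \<noteq> 0" for m
  proof -
    have "monom_deg m \<noteq> 0" using that by (auto simp: monom_deg_def intro!: poly_mapping_eqI)
    then show ?thesis using assms by (auto simp: forms_iff)
  qed
  then show ?thesis by (intro poly_mapping_eqI) (simp add: lookup_single when_def)
qed

text \<open>A member of degree 0 is a constant: zero is not regular modulo a proper ideal, and a unit
  would generate the whole ring.\<close>

lemma regular_sequence_degree_pos:
  fixes F :: "nat \<Rightarrow> ('n::finite, 'k::field) mpol"
  assumes reg: "regular_sequence F r" and F: "F j \<in> forms i" and j: "j \<in> {1..r}"
  shows "i \<ge> 1"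
proof (rule ccontr)
  assume "\<not> i \<ge> 1"
  then have "i = 0" by simp
  with F have "F j \<in> forms 0" by simp
  then have F0: "F j = Poly_Mapping.single 0 (Poly_Mapping.lookup (F j) 0)" by (rule form_of_degree_zero)
  let ?I = "ideal_gen (F ` {1..r})"
  have no1: "1 \<notin> ?I"
  proof
    assume "1 \<in> ?I"
    then have "x * 1 \<in> ?I" for x by (rule ideal.span_scale)
    then have "?I = UNIV" by auto
    then show False using reg by (simp add: regular_sequence_def)
  qed
  show False
  proof (cases "Poly_Mapping.lookup (F j) 0 = 0")
    case True
    then have "F j * 1 = 0" using F0 by simp
    then have "F j * 1 \<in> ideal_gen (F ` {1..<j})" using ideal.span_zero by metis
    then have "1 \<in> ideal_gen (F ` {1..<j})" using reg j unfolding regular_sequence_def by blast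
    moreover have "ideal_gen (F ` {1..<j}) \<subseteq> ?I" using j by (intro ideal.span_mono) auto
    ultimately show False using no1 by blast
  next
    case False
    have "Poly_Mapping.single 0 (inverse (Poly_Mapping.lookup (F j) 0)) * F j = 1"
      by (subst F0) (use False in \<open>simp add: mult_single\<close>)
    moreover have "Poly_Mapping.single 0 (inverse (Poly_Mapping.lookup (F j) 0)) * F j \<in> ?I"
      using j by (intro ideal.span_scale ideal.span_base) auto
    ultimately show False using no1 by metis
  qed
qed

theorem proposition5p4:
  fixes F :: "nat \<Rightarrow> ('n::finite, 'k::field) mpol"
    and d :: "nat \<Rightarrow> nat"
    and n :: nat
    and I :: "('n, 'k) mpol set"
  assumes "infinite (UNIV :: 'k set)"
    and "n = card (UNIV :: 'n set)"
    and "I = ideal_gen (F ` {1..n+1})"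
    and "\<And>j. j \<in> {1..n+1} \<Longrightarrow> F j \<in> forms (d j)"
    and "height I = enat n"
    and "almost_complete_intersection I"
    and "artinian_ideal I"
    and "int (d (n+1)) \<ge> \<lceil>real (\<Sum>j=1..n. d j) / 2\<rceil> - 1"
    and "regular_sequence F n"
    and "even (int (\<Sum>j=1..n. d j) - int n) \<Longrightarrow>
           int (d n) > int (\<Sum>j=1..<n. d j) - int n"
    and "odd (int (\<Sum>j=1..n. d j) - int n) \<Longrightarrow>
           int (d n) > int (\<Sum>j=1..<n. d j) - int n + 1"
  shows "weak_lefschetz I"
proof -
  note inf = assms(1) and F = assms(4)
  have "n \<ge> 1" using assms(2) by (simp add: Suc_leI finite_UNIV_card_ge_0)
  then obtain r where r: "n = Suc r" by (cases n) auto
  define J where "J = ideal_gen (F ` {1..r})"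
  define e where "e = (\<Sum>j=1..r. d j - 1)"
  have idx: "{1..<n} = {1..r}" "{1..n} = insert n {1..r}" using r by auto
  have I: "is_ideal I" unfolding assms(3) by (rule ideal.subspace_span)
  have JI: "J \<subseteq> I" unfolding J_def assms(3) using r by (intro ideal.span_mono) auto
  have nzd: "g \<in> ideal_gen (F ` {1..<j})" if "j \<in> {1..n}" "F j * g \<in> ideal_gen (F ` {1..<j})" for j g
    using assms(9) that unfolding regular_sequence_def by blast
  have dpos: "d j \<ge> 1" if "j \<in> {1..n}" for j
    using regular_sequence_degree_pos[OF assms(9) F that] that by auto

  have sum_d: "(\<Sum>j=1..r. d j) = e + r"
  proof -
    have "(\<Sum>j=1..r. d j) = (\<Sum>j=1..r. (d j - 1) + 1)"
    proof (rule sum.cong)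
      fix j assume "j \<in> {1..r}"
      then show "d j = d j - 1 + 1" using dpos[of j] r by simp
    qed simp
    then show ?thesis by (simp only: sum.distrib e_def) simp
  qed
  have sum_n: "(\<Sum>j=1..n. d j) = d n + e + r" using sum_d r by simp
  have dn: "d n \<ge> e + 1"
  proof (cases "even (int (\<Sum>j=1..n. d j) - int n)")
    case True
    have "int (d n) > int (e + r) - int n" using assms(10)[OF True] unfolding idx sum_d .
    then have "d n \<ge> e" using r by linarith
    \<comment> \<open>Equality would make the parity odd.\<close>
    moreover have "d n \<noteq> e"
    proof
      assume "d n = e"
      then have "int (d n + e + r) - int n = 2 * int e - 1" using r by simp
      moreover have "odd (2 * int e - 1)" by simp
      ultimately show False using True unfolding sum_n by metis
    qed
    ultimately show ?thesis by simp
  next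
    case False
    have "int (d n) > int (e + r) - int n + 1" using assms(11)[OF False] unfolding idx sum_d .
    then show ?thesis using r by linarith
  qed
  have dn1: "2 * d (n+1) + 2 \<ge> d n + e + r"
  proof -
    have "real (d n + e + r) / 2 \<le> of_int \<lceil>real (d n + e + r) / 2\<rceil>" by (rule le_of_int_ceiling)
    also have "\<dots> \<le> of_int (int (d (n+1)) + 1)"
      using assms(8) unfolding sum_n by (subst of_int_le_iff) simp
    finally have "real (d n + e + r) \<le> real (2 * d (n+1) + 2)" by simp
    then show ?thesis by (simp only: of_nat_le_iff)
  qed
  obtain k where k: "d n = Suc k" using dn by (cases "d n") auto
  have rank_J: "generic (\<lambda>a. (\<forall>i\<le>e. \<forall>g\<in>forms i. linear_form a * g \<in> J \<longrightarrow> g \<in> J) \<and>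
    (\<forall>i\<ge>e. \<forall>f\<in>forms (Suc i). \<exists>g\<in>forms i. f - linear_form a * g \<in> J))"
    unfolding J_def
  proof (rule generic_section_of_regular_sequence[OF inf])
    show "Suc r = card (UNIV :: 'n set)" using r assms(2) by simp
    show "F j \<in> forms (d j)" if "j \<in> {1..r}" for j using F that r by auto
    show "g \<in> ideal_gen (F ` {1..<j})" if "j \<in> {1..r}" "F j * g \<in> ideal_gen (F ` {1..<j})" for j g
      using nzd that r by auto
    show "F n \<in> forms (Suc k)" using F[of n] k r by simp
    show "g \<in> ideal_gen (F ` {1..r})" if "F n * g \<in> ideal_gen (F ` {1..r})" for g
      using nzd[of n g] that r unfolding idx by simp
  qed (rule e_def)
  have coprime: "generic (\<lambda>a. n = 2 \<and> F (n+1) \<noteq> 0 \<longrightarrow>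
      (\<forall>g c. linear_form a * g = smul c (F (n+1)) \<longrightarrow> c = 0))"
  proof (cases "n = 2 \<and> F (n+1) \<noteq> 0")
    case True
    show ?thesis
      by (rule generic_mono[OF generic_not_divisor[OF inf _ F[of "n+1"]]]) (use True assms(2) in auto)
  qed (rule generic_mono[OF generic_True], blast)
  show ?thesis
  proof (rule weak_lefschetz_if_generic, rule generic_mono[OF generic_conj[OF inf rank_J coprime]], intro allI)
    fix a :: "'n \<Rightarrow> 'k" and i
    let ?L = "linear_form a"
    assume "((\<forall>i\<le>e. \<forall>g\<in>forms i. ?L * g \<in> J \<longrightarrow> g \<in> J) \<and>
        (\<forall>i\<ge>e. \<forall>f\<in>forms (Suc i). \<exists>g\<in>forms i. f - ?L * g \<in> J)) \<and>
      (n = 2 \<and> F (n+1) \<noteq> 0 \<longrightarrow> (\<forall>g c. ?L * g = smul c (F (n+1)) \<longrightarrow> c = 0))"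
    then have inj: "\<And>i g. i \<le> e \<Longrightarrow> g \<in> forms i \<Longrightarrow> ?L * g \<in> J \<Longrightarrow> g \<in> J"
      and surj: "\<And>i f. i \<ge> e \<Longrightarrow> f \<in> forms (Suc i) \<Longrightarrow> \<exists>g\<in>forms i. f - ?L * g \<in> J"
      and cop: "\<And>g c. n = 2 \<Longrightarrow> F (n+1) \<noteq> 0 \<Longrightarrow> ?L * g = smul c (F (n+1)) \<Longrightarrow> c = 0"
      by blast+
    show "maximal_rank_at I ?L i"
    proof (cases "e \<le> i")
      case True
      show ?thesis
        by (rule maximal_rank_if_surjective[OF I linear_form_in_forms]) (use surj[OF True] JI in blast)
    next
      case False
      show ?thesis
      proof (rule maximal_rank_if_injective[OF I])
        fix g assume g: "g \<in> forms i" "?L * g \<in> I"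
        have Lg: "?L * g \<in> forms (Suc i)" using mult_in_forms[OF linear_form_in_forms g(1)] by simp
        have Lg_I: "?L * g \<in> ideal_gen (F ` {1..n+1})" using g(2) assms(3) by simp
        obtain h where h: "\<And>j. h j \<in> forms (Suc i - d j)"
          "?L * g = (\<Sum>j\<in>{j\<in>{1..n+1}. d j \<le> Suc i}. F j * h j)"
          by (rule form_in_ideal_gen[OF _ F Lg_I Lg]) auto
        \<comment> \<open>In degree \<open>i + 1 \<le> e < d n\<close> the generator \<open>F n\<close> cannot contribute.\<close>
        have "?L * g \<in> J"
        proof (cases "d (n+1) \<le> Suc i")
          case False
          have "j \<in> {1..r}" if "j \<in> {j\<in>{1..n+1}. d j \<le> Suc i}" for j
            using that False dn \<open>\<not> e \<le> i\<close> r by (cases "j = n"; cases "j = n + 1") auto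
          then have "F j \<in> J" if "j \<in> {j\<in>{1..n+1}. d j \<le> Suc i}" for j
            using that unfolding J_def by (intro ideal.span_base) auto
          then have "h j * F j \<in> J" if "j \<in> {j\<in>{1..n+1}. d j \<le> Suc i}" for j
            using that unfolding J_def by (intro ideal.span_scale) auto
          then show ?thesis unfolding h(2) J_def mult.commute[of "F _"] by (intro ideal.span_sum) blast
        next
          case True
          \<comment> \<open>The degree bounds leave only two variables with \<open>d 1 = e + 1\<close>, \<open>d 3 = e\<close>, \<open>i = e - 1\<close>; there the
            degree \<open>e\<close> piece of \<open>I\<close> consists of the multiples of the last generator.\<close>
          have rn: "r = 1" and ei: "Suc i = e" "d (n+1) = e"
          proof -
            have "r \<noteq> 0"
            proof
              assume "r = 0"
              then have "e = 0" by (simp add: e_def)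
              then show False using \<open>\<not> e \<le> i\<close> by simp
            qed
            then show "r = 1" "Suc i = e" "d (n+1) = e" using True False dn dn1 by linarith+
          qed
          have n: "n = 2" using rn r by simp
          have "d 1 = e + 1" using sum_d rn by simp
          then have "{j\<in>{1..n+1}. d j \<le> Suc i} = {n+1}"
            using ei dn n by (auto simp: atLeastAtMost_iff le_Suc_eq numeral_2_eq_2)
          then have Lg_eq: "?L * g = F (n+1) * h (n+1)" using h(2) by simp
          have "h (n+1) \<in> forms 0" using h(1)[of "n+1"] ei by simp
          then have "h (n+1) = Poly_Mapping.single 0 (Poly_Mapping.lookup (h (n+1)) 0)"
            by (rule form_of_degree_zero)
          then have eq: "?L * g = smul (Poly_Mapping.lookup (h (n+1)) 0) (F (n+1))"
            unfolding Lg_eq smul_def by (metis mult.commute)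
          have "?L * g = 0"
          proof (cases "F (n+1) = 0")
            case False
            show ?thesis using eq cop[OF n False eq] by simp
          qed (simp add: Lg_eq)
          then show ?thesis using ideal.span_zero by (simp add: J_def)
        qed
        then show "g \<in> I" using inj[of i g] False g(1) JI by auto
      qed
    qed
  qed
qed

end
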